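(* Let $\mathbf{S}$ be a canonical single-parameter exponential family with divergence $d(\cdot,\cdot)$, and let $\pi_1$ be the KL-based confidence-interval policy with threshold $\beta(\delta)=\log(2/\delta)$. Then for every $\nu\in\mathbf{S}$ with mean $\mu$ and standard deviation $\sigma(\mu)$, and every $N_\delta\to\infty$ (as $\delta\to 0$) for which $\lim_{\delta\to0}N_\delta/\log(1/\delta)$ exists in $[0,\infty]$: (a) $\pi_1\in\Pi^{sr}_{\rm CI}$. (b) If $\lim_{\delta\to0}\frac{N_\delta}{\log(1/\delta)}=\infty$, then, as $\delta\to0$, $$\frac{\widehat\mu_R^{\pi_1}(N_\delta,\delta)-\widehat\mu_L^{\pi_1}(N_\delta,\delta)}{\sqrt{\log(1/\delta)/N_\delta}}\ \overset{p}{\to}\ \sqrt8\,\sigma(\mu).$$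
   Context: Exponential family. Fix a reference measure $\xi$ on $\mathbb{R}$. $\mathbf{S}=\{p_\theta:\theta\in\Theta\}$, with $\frac{dp_\theta}{d\xi}(x)=\exp(\theta x-b(\theta))$, where $\Theta=\{\theta\in\mathbb{R}:\int|x|e^{\theta x}\,d\xi(x)<\infty\}$ is assumed to be an open interval, and $b$ is a twice differentiable, strictly convex function. The mean of $p_\theta$ is $b'(\theta)$, strictly increasing in $\theta$; its inverse is $\mu\mapsto\theta(\mu)$. The set of means is the open interval $\mathbf{O}=(\underline\mu,\overline\mu)$ (endpoints possibly infinite). For $\mu,\tilde\mu\in\mathbf{O}$, $d(\mu,\tilde\mu)=KL(p_{\theta(\mu)},p_{\theta(\tilde\mu)})=b(\theta(\tilde\mu))-b(\theta(\mu))-b'(\theta(\mu))(\theta(\tilde\mu)-\theta(\mu))$. Equivalently $d(y,q)=\sup_{\lambda\in\mathbb{R}}\{\lambda y-\log\mathbb{E}_{p_{\theta(q)}}[e^{\lambda X}]\}$, and this formula defines $d(y,q)\in[0,\infty]$ for $q\in\mathbf{O}$ when $y\notin\mathbf{O}$. Policies. $X_1,X_2,\dots$ are i.i.d. from $\nu$; $\mathbb{P}_\nu$ is the corresponding probability. A policy $\pi$ assigns to each $n\in\mathbb{N}$ and $\delta\in(0,1)$ an interval $[\widehat\mu_L^\pi(n,\delta),\widehat\mu_R^\pi(n,\delta)]$ whose (extended-real) endpoints are measurable functions of $X_1,\dots,X_n$. $\Pi_{\rm CI}$ is the set of policies such that for every $\nu\in\mathbf{S}$ with mean $\mu$, every $\delta\in(0,1)$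 and every $n\in\mathbb{N}$, $\mathbb{P}_\nu(\mu\in[\widehat\mu_L^\pi(n,\delta),\widehat\mu_R^\pi(n,\delta)])\ge1-\delta$. Stability. $N_\delta$ is a positive-integer-valued function of $\delta\in(0,1)$. A policy $\pi\in\Pi_{\rm CI}$ is stable (for $\nu$ with mean $\mu$ and $N_\delta$) if, as $\delta\to0$, under $\mathbb{P}_\nu$, $\widehat\mu_L^\pi(N_\delta,\delta)$ and $\widehat\mu_R^\pi(N_\delta,\delta)$ converge in probability to deterministic constants $\mu_L^\pi(\mu)\le\mu$ and $\mu_R^\pi(\mu)\ge\mu$ ($\pm\infty$ allowed). $\Pi^s_{\rm CI}$ is the set of stable policies in $\Pi_{\rm CI}$. $\Pi^{sr}_{\rm CI}\subseteq\Pi^s_{\rm CI}$ is the set of stable policies such that, when $\lim_{\delta\to0}N_\delta/\log(1/\delta)=\infty$, under $\mathbb{P}_\nu$ as $\delta\to0$, $\frac{\mu-\widehat\mu_L^\pi(N_\delta,\delta)}{\sqrt{\log(1/\delta)/N_\delta}}$ and $\frac{\widehat\mu_R^\pi(N_\delta,\delta)-\mu}{\sqrt{\log(1/\delta)/N_\delta}}$ converge in probability to non-negative (finite) constants. Policy $\pi_1$. With $\hat\mu_n=\frac1n\sum_{t=1}^nX_t$ and $\beta(\delta)=\log(2/\delta)$, $\widehat\mu_R^{\pi_1}(n,\delta)=\sup\{q\in\mathbf{O}:q>\hat\mu_n,\ n\,d(\hat\mu_n,q)\le\beta(\delta)\}$ and $\widehat\mu_L^{\pi_1}(n,\delta)=\inf\{q\in\mathbf{O}:q<\hat\mu_n,\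 n\,d(\hat\mu_n,q)\le\beta(\delta)\}$, each taken to be $\hat\mu_n$ if the corresponding set is empty. *)

theory Defs
  imports "HOL-Probability.Probability"
begin

section \<open>One-parameter exponential families on the real line\<close>

definition nat_params :: "real measure \<Rightarrow> real set" where
  "nat_params \<xi> = {\<theta>. (\<integral>\<^sup>+x. ennreal (\<bar>x\<bar> * exp (\<theta> * x)) \<partial>\<xi>) < \<infinity>}"

definition exp_dist :: "real measure \<Rightarrow> (real \<Rightarrow> real) \<Rightarrow> real \<Rightarrow> real measure" where
  "exp_dist \<xi> b \<theta> = density \<xi> (\<lambda>x. ennreal (exp (\<theta> * x - b \<theta>)))"

text \<open>
  The assumption \<open>prob_exp_dist\<close> determines \<open>b\<close> on the parameter set as the
  log-normaliser of \<open>\<xi>\<close>; values of \<open>b\<close> outside the parameter set are irrelevant.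
\<close>

locale exp_family =
  fixes \<xi> :: "real measure" and b :: "real \<Rightarrow> real"
  assumes sets_ref: "sets \<xi> = sets borel"
    and open_params: "open (nat_params \<xi>)"
    and interval_params: "is_interval (nat_params \<xi>)"
    and prob_exp_dist: "\<And>\<theta>. \<theta> \<in> nat_params \<xi> \<Longrightarrow> prob_space (exp_dist \<xi> b \<theta>)"
    and b_differentiable: "\<And>\<theta>. \<theta> \<in> nat_params \<xi> \<Longrightarrow> b differentiable (at \<theta>)"
    and b_twice_differentiable: "\<And>\<theta>. \<theta> \<in> nat_params \<xi> \<Longrightarrow> deriv b differentiable (at \<theta>)"
    and b_strictly_convex:
      "\<And>x y t. x \<in> nat_params \<xi> \<Longrightarrow> y \<in> nat_params \<xi> \<Longrightarrow> x \<noteq> y \<Longrightarrow> 0 < t \<Longrightarrow> t < 1 \<Longrightarrow>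
        b ((1 - t) * x + t * y) < (1 - t) * b x + t * b y"

definition exp_models :: "real measure \<Rightarrow> (real \<Rightarrow> real) \<Rightarrow> real measure set" where
  "exp_models \<xi> b = exp_dist \<xi> b ` nat_params \<xi>"

definition dist_mean :: "real measure \<Rightarrow> real" where
  "dist_mean \<nu> = (\<integral>x. x \<partial>\<nu>)"

definition dist_sd :: "real measure \<Rightarrow> real" where
  "dist_sd \<nu> = sqrt (\<integral>x. (x - dist_mean \<nu>)\<^sup>2 \<partial>\<nu>)"

definition means :: "real measure \<Rightarrow> (real \<Rightarrow> real) \<Rightarrow> real set" where
  "means \<xi> b = dist_mean ` exp_models \<xi> b"

definition param_of_mean :: "real measure \<Rightarrow> (real \<Rightarrow> real) \<Rightarrow> real \<Rightarrow> real" where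
  "param_of_mean \<xi> b = the_inv_into (nat_params \<xi>) (\<lambda>\<theta>. dist_mean (exp_dist \<xi> b \<theta>))"

definition model_of_mean :: "real measure \<Rightarrow> (real \<Rightarrow> real) \<Rightarrow> real \<Rightarrow> real measure" where
  "model_of_mean \<xi> b \<mu> = exp_dist \<xi> b (param_of_mean \<xi> b \<mu>)"

text \<open>Extended-real logarithm of the moment generating function, \<open>\<infinity>\<close> where the latter diverges.\<close>

definition log_mgf :: "real measure \<Rightarrow> real \<Rightarrow> ereal" where
  "log_mgf \<nu> t =
    (let m = \<integral>\<^sup>+x. ennreal (exp (t * x)) \<partial>\<nu> in if m = \<infinity> then \<infinity> else ereal (ln (enn2real m)))"

text \<open>
  The library's \<open>KL_divergence (exp 1) M N\<close> is the divergence of \<open>N\<close> from the reference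
  \<open>M\<close>, i.e. \<open>KL(N, M)\<close> in the usual notation, with natural logarithms. The divergence
  \<open>kl_div \<xi> b y q\<close> is only used for \<open>q\<close> in the set of means.
\<close>

definition kl_div :: "real measure \<Rightarrow> (real \<Rightarrow> real) \<Rightarrow> real \<Rightarrow> real \<Rightarrow> ereal" where
  "kl_div \<xi> b y q =
    (if y \<in> means \<xi> b
     then ereal (KL_divergence (exp 1) (model_of_mean \<xi> b q) (model_of_mean \<xi> b y))
     else (SUP t::real. ereal (t * y) - log_mgf (model_of_mean \<xi> b q) t))"

section \<open>Sampling and convergence in probability\<close>

text \<open>
  Law of an i.i.d. sequence with marginal \<open>\<nu>\<close>. Coordinates are numbered from 0: the
  observations \<open>X\<^sub>1, \<dots>, X\<^sub>n\<close> are the coordinates in \<open>{..<n}\<close>.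
\<close>

definition iid_seq :: "real measure \<Rightarrow> (nat \<Rightarrow> real) measure" where
  "iid_seq \<nu> = Pi\<^sub>M UNIV (\<lambda>_. \<nu>)"

text \<open>
  Neighbourhood formulation, so that the limit may also be \<open>\<plusminus>\<infinity>\<close>. As usual this is
  meaningful for functions that are measurable for \<open>\<delta>\<close> close to the limit.
\<close>

definition tendsto_in_prob ::
    "'w measure \<Rightarrow> ('i \<Rightarrow> 'w \<Rightarrow> 'a::topological_space) \<Rightarrow> 'a \<Rightarrow> 'i filter \<Rightarrow> bool" where
  "tendsto_in_prob M f c F \<longleftrightarrow>
    (\<forall>U. open U \<longrightarrow> c \<in> U \<longrightarrow>
      ((\<lambda>i. measure M {\<omega> \<in> space M. f i \<omega> \<notin> U}) \<longlongrightarrow> 0) F)"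

section \<open>Confidence-interval policies\<close>

text \<open>
  A policy maps a sample size \<open>n\<close>, a level \<open>\<delta>\<close> and the data to the two endpoints. It is fed
  the data restricted to \<open>{..<n}\<close>, hence depends on the first \<open>n\<close> observations only; its
  values for \<open>n = 0\<close> or \<open>\<delta>\<close> outside the open unit interval are irrelevant.
\<close>

type_synonym policy = "nat \<Rightarrow> real \<Rightarrow> (nat \<Rightarrow> real) \<Rightarrow> ereal \<times> ereal"

definition ci_left :: "policy \<Rightarrow> nat \<Rightarrow> real \<Rightarrow> (nat \<Rightarrow> real) \<Rightarrow> ereal" where
  "ci_left \<pi> n \<delta> \<omega> = fst (\<pi> n \<delta> (restrict \<omega> {..<n}))"

definition ci_right :: "policy \<Rightarrow> nat \<Rightarrow> real \<Rightarrow> (nat \<Rightarrow> real) \<Rightarrow> ereal" where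
  "ci_right \<pi> n \<delta> \<omega> = snd (\<pi> n \<delta> (restrict \<omega> {..<n}))"

definition is_policy :: "policy \<Rightarrow> bool" where
  "is_policy \<pi> \<longleftrightarrow>
    (\<forall>n \<delta>. 0 < n \<longrightarrow> 0 < \<delta> \<longrightarrow> \<delta> < 1 \<longrightarrow>
      (\<lambda>x. fst (\<pi> n \<delta> x)) \<in> borel_measurable (Pi\<^sub>M {..<n} (\<lambda>_. borel)) \<and>
      (\<lambda>x. snd (\<pi> n \<delta> x)) \<in> borel_measurable (Pi\<^sub>M {..<n} (\<lambda>_. borel)) \<and>
      (\<forall>\<omega>. ci_left \<pi> n \<delta> \<omega> \<le> ci_right \<pi> n \<delta> \<omega>))"

definition Pi_CI :: "real measure \<Rightarrow> (real \<Rightarrow> real) \<Rightarrow> policy set" where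
  "Pi_CI \<xi> b =
    {\<pi>. is_policy \<pi> \<and>
      (\<forall>\<nu> \<in> exp_models \<xi> b. \<forall>n \<delta>. 0 < n \<longrightarrow> 0 < \<delta> \<longrightarrow> \<delta> < 1 \<longrightarrow>
        measure (iid_seq \<nu>)
          {\<omega> \<in> space (iid_seq \<nu>).
            ci_left \<pi> n \<delta> \<omega> \<le> ereal (dist_mean \<nu>) \<and> ereal (dist_mean \<nu>) \<le> ci_right \<pi> n \<delta> \<omega>}
        \<ge> 1 - \<delta>)}"

definition Pi_CI_stable ::
    "real measure \<Rightarrow> (real \<Rightarrow> real) \<Rightarrow> real measure \<Rightarrow> (real \<Rightarrow> nat) \<Rightarrow> policy set" where
  "Pi_CI_stable \<xi> b \<nu> N =
    {\<pi> \<in> Pi_CI \<xi> b.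
      \<exists>l r. l \<le> ereal (dist_mean \<nu>) \<and> ereal (dist_mean \<nu>) \<le> r \<and>
        tendsto_in_prob (iid_seq \<nu>) (\<lambda>\<delta>. ci_left \<pi> (N \<delta>) \<delta>) l (at_right 0) \<and>
        tendsto_in_prob (iid_seq \<nu>) (\<lambda>\<delta>. ci_right \<pi> (N \<delta>) \<delta>) r (at_right 0)}"

definition sample_ratio :: "(real \<Rightarrow> nat) \<Rightarrow> real \<Rightarrow> real" where
  "sample_ratio N \<delta> = real (N \<delta>) / ln (1 / \<delta>)"

definition ci_scale :: "(real \<Rightarrow> nat) \<Rightarrow> real \<Rightarrow> real" where
  "ci_scale N \<delta> = sqrt (ln (1 / \<delta>) / real (N \<delta>))"

definition Pi_CI_stable_regular ::
    "real measure \<Rightarrow> (real \<Rightarrow> real) \<Rightarrow> real measure \<Rightarrow> (real \<Rightarrow> nat) \<Rightarrow> policy set" where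
  "Pi_CI_stable_regular \<xi> b \<nu> N =
    {\<pi> \<in> Pi_CI_stable \<xi> b \<nu> N.
      filterlim (sample_ratio N) at_top (at_right 0) \<longrightarrow>
      (\<exists>l r :: real. 0 \<le> l \<and> 0 \<le> r \<and>
        tendsto_in_prob (iid_seq \<nu>)
          (\<lambda>\<delta> \<omega>. (ereal (dist_mean \<nu>) - ci_left \<pi> (N \<delta>) \<delta> \<omega>) / ereal (ci_scale N \<delta>))
          (ereal l) (at_right 0) \<and>
        tendsto_in_prob (iid_seq \<nu>)
          (\<lambda>\<delta> \<omega>. (ci_right \<pi> (N \<delta>) \<delta> \<omega> - ereal (dist_mean \<nu>)) / ereal (ci_scale N \<delta>))
          (ereal r) (at_right 0))}"

section \<open>The KL-based policy\<close>

definition emp_mean :: "nat \<Rightarrow> (nat \<Rightarrow> real) \<Rightarrow> real" where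
  "emp_mean n x = (\<Sum>t<n. x t) / real n"

definition kl_right :: "real measure \<Rightarrow> (real \<Rightarrow> real) \<Rightarrow> nat \<Rightarrow> real \<Rightarrow> real \<Rightarrow> ereal" where
  "kl_right \<xi> b n \<beta> m =
    (let A = {q \<in> means \<xi> b. m < q \<and> ereal (real n) * kl_div \<xi> b m q \<le> ereal \<beta>}
     in if A = {} then ereal m else Sup (ereal ` A))"

definition kl_left :: "real measure \<Rightarrow> (real \<Rightarrow> real) \<Rightarrow> nat \<Rightarrow> real \<Rightarrow> real \<Rightarrow> ereal" where
  "kl_left \<xi> b n \<beta> m =
    (let A = {q \<in> means \<xi> b. q < m \<and> ereal (real n) * kl_div \<xi> b m q \<le> ereal \<beta>}
     in if A = {} then ereal m else Inf (ereal ` A))"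

definition kl_policy :: "real measure \<Rightarrow> (real \<Rightarrow> real) \<Rightarrow> policy" where
  "kl_policy \<xi> b n \<delta> x =
    (kl_left \<xi> b n (ln (2 / \<delta>)) (emp_mean n x), kl_right \<xi> b n (ln (2 / \<delta>)) (emp_mean n x))"

end

theory Submission
  imports Defs "HOL-Real_Asymp.Real_Asymp"
begin

text \<open>
  Two facts carry the theorem: the divergence of the family is at the same time a Bregman
  divergence of the log-normaliser \<open>b\<close> and the Legendre transform of a log moment generating
  function.

  \<^emph>\<open>Coverage\<close> uses the Legendre form (\<open>kl_div_eq_Legendre\<close>). If the true mean \<open>\<mu>\<close> lies above the
  right end, then the empirical mean \<open>y\<close> lies below \<open>\<mu>\<close> and \<open>n d(y, \<mu>) > \<beta>\<close>, so that some slope \<open>u\<close>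
  in the Legendre supremum certifies \<open>u y - \<Lambda>(u) > \<beta> / n\<close>. Chernoff's bound with this slope gives the
  event ``empirical mean at most \<open>y\<close>'' probability at most \<open>exp (- \<beta>) = \<delta> / 2\<close>. The right end is
  monotone in the empirical mean, so the bad values of \<open>y\<close> form a down-closed set, and the same bound
  holds for their union (\<open>prob_down_closed_le\<close>). The left end is symmetric, and the two errors add up
  to \<open>\<delta>\<close> (\<open>kl_policy_in_Pi_CI\<close>). Monotonicity also makes the ends measurable.

  \<^emph>\<open>Limits\<close> use the Bregman form. In the natural parameter, the right end for empirical mean \<open>b' a\<close> is
  the supremum of \<open>b' t\<close> over the \<open>t \<ge> a\<close> in the Bregman ball \<open>B(a, t) \<le> \<beta> / n\<close>. This is a
  deterministic function of \<open>a\<close> and \<open>\<beta> / n\<close>. It is jointly continuous, also where the ball reaches the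
  end of the parameter interval and at radius \<open>\<infinity>\<close> (\<open>tendsto_upper_end\<close>); as \<open>\<beta> / n\<close> converges in
  \<open>[0, \<infinity>]\<close> and the empirical mean concentrates, stability follows. When \<open>\<beta> / n \<rightarrow> 0\<close>, write
  \<open>e\<^sup>2 = log (1 / \<delta>) / n\<close>, so that \<open>\<beta> / n \<sim> e\<^sup>2\<close>. Since \<open>B(a, a + c e) \<sim> b'' c\<^sup>2 e\<^sup>2 / 2\<close>, the ball ends at
  \<open>c = sqrt (2 / b'')\<close>, and its image under \<open>b'\<close> ends at \<open>\<mu> + sqrt (2 b'') e\<close>
  (\<open>upper_end_asymptotics\<close>). The fluctuations of the empirical mean are of order \<open>1 / sqrt n\<close>, which is
  \<open>o(e)\<close> because \<open>log (1 / \<delta>) \<rightarrow> \<infinity>\<close>, and so they do not affect the limit. As \<open>b''\<close> is the variance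
  (\<open>variance_exp_dist\<close>), the two halves add up to \<open>2 sqrt 2 \<sigma> = sqrt 8 \<sigma>\<close>.
\<close>

section \<open>Limits and Taylor remainders\<close>

lemma order_tendsto_less:
  fixes x y :: "'a::linorder_topology"
  assumes "x < y" "(f \<longlongrightarrow> x) F" "(g \<longlongrightarrow> y) F"
  shows "eventually (\<lambda>z. f z < g z) F"
proof (cases "\<exists>c. x < c \<and> c < y")
  case True
  then obtain c where c: "x < c" "c < y" by blast
  from order_tendstoD(2)[OF assms(2) c(1)] order_tendstoD(1)[OF assms(3) c(2)]
  show ?thesis by eventually_elim auto
next
  case False
  from order_tendstoD(2)[OF assms(2,1)] order_tendstoD(1)[OF assms(3,1)]
  show ?thesis by eventually_elim (use False in force)
qed

text \<open>
  Remainders are stated along \<open>nhds 0\<close>, not \<open>at 0\<close>: the quotient vanishes at \<open>0\<close> by the convention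
  \<open>x / 0 = 0\<close>, so it may be composed with increments that are sometimes zero.
\<close>

lemma first_order_remainder:
  assumes "(h has_real_derivative v) (at x)"
  shows "((\<lambda>t. (h (x + t) - h x - v * t) / t) \<longlongrightarrow> 0) (nhds 0)"
proof -
  have "((\<lambda>t. (h (x + t) - h x) / t) \<longlongrightarrow> v) (at 0)"
    using assms by (simp add: DERIV_def)
  then have "((\<lambda>t. (h (x + t) - h x) / t - v) \<longlongrightarrow> 0) (at 0)"
    using LIM_zero by blast
  then have "((\<lambda>t. (h (x + t) - h x - v * t) / t) \<longlongrightarrow> 0) (at 0)"
    by (rule Lim_transform_eventually)
      (rule eventually_mono[OF eventually_neq_at_within[of 0]], simp add: diff_divide_distrib)
  then show ?thesis
    using tendsto_at_iff_tendsto_nhds[of "\<lambda>t. (h (x + t) - h x - v * t) / t" 0] by simp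
qed

text \<open>
  Taylor--Young: differentiability of \<open>f'\<close> at the single point \<open>x\<close> suffices, because the mean value
  theorem turns the remainder of \<open>f\<close> into \<open>t\<close> times the first-order remainder of \<open>f'\<close>.
\<close>

lemma second_order_remainder:
  assumes U: "open U" "x \<in> U"
    and f: "\<And>s. s \<in> U \<Longrightarrow> (f has_real_derivative f' s) (at s)"
    and f': "(f' has_real_derivative v) (at x)"
  shows "((\<lambda>t. (f (x + t) - f x - f' x * t - v * t\<^sup>2 / 2) / t\<^sup>2) \<longlongrightarrow> 0) (nhds 0)"
proof -
  define R where "R t = f (x + t) - f x - f' x * t - v * t\<^sup>2 / 2" for t
  define r where "r t = f' (x + t) - f' x - v * t" for t
  obtain d0 where d0: "0 < d0" "ball x d0 \<subseteq> U"
    using U open_contains_ball by blast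
  have deriv_R: "(R has_real_derivative r t) (at t)" if "\<bar>t\<bar> < d0" for t
  proof -
    have "x + t \<in> U" using d0 that by (auto simp: dist_real_def)
    from f[OF this] have "((\<lambda>t. f (x + t)) has_real_derivative f' (x + t)) (at t)"
      by (simp add: DERIV_shift add.commute)
    then show ?thesis
      unfolding R_def r_def by (auto intro!: derivative_eq_intros)
  qed
  have "((\<lambda>t. r t / t) \<longlongrightarrow> 0) (nhds 0)"
    unfolding r_def using first_order_remainder[OF f'] .
  have "((\<lambda>t. R t / t\<^sup>2) \<longlongrightarrow> 0) (nhds 0)"
  proof (rule tendstoI)
    fix e :: real assume "0 < e"
    then have "eventually (\<lambda>t. \<bar>r t / t\<bar> < e) (nhds 0)"
      using tendstoD[OF \<open>((\<lambda>t. r t / t) \<longlongrightarrow> 0) (nhds 0)\<close> \<open>0 < e\<close>] by simp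
    then obtain d1 where d1: "0 < d1" "\<And>t. \<bar>t\<bar> < d1 \<Longrightarrow> \<bar>r t / t\<bar> < e"
      unfolding eventually_nhds_metric by auto
    have "\<bar>R t / t\<^sup>2\<bar> < e" if t: "\<bar>t\<bar> < min d0 d1" for t
    proof (cases "t = 0")
      case False
      have r_bound: "\<bar>r z\<bar> < e * \<bar>t\<bar>" if "z \<noteq> 0" "\<bar>z\<bar> \<le> \<bar>t\<bar>" for z
      proof -
        have "\<bar>r z\<bar> < e * \<bar>z\<bar>"
          using d1(2)[of z] that t by (simp add: abs_divide pos_divide_less_eq)
        also have "\<dots> \<le> e * \<bar>t\<bar>" using that \<open>0 < e\<close> by simp
        finally show ?thesis .
      qed
      have "\<exists>z. z \<noteq> 0 \<and> \<bar>z\<bar> \<le> \<bar>t\<bar> \<and> R t = t * r z"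
      proof (cases "0 < t")
        case True
        have "\<exists>z>0. z < t \<and> R t - R 0 = (t - 0) * r z"
          by (rule MVT2) (use True t deriv_R in auto)
        then obtain z where "0 < z" "z < t" "R t = t * r z" by (auto simp: R_def)
        then show ?thesis using True by (intro exI[of _ z]) simp
      next
        case False
        with \<open>t \<noteq> 0\<close> have "t < 0" by simp
        have "\<exists>z>t. z < 0 \<and> R 0 - R t = (0 - t) * r z"
          by (rule MVT2) (use \<open>t < 0\<close> t deriv_R in auto)
        then obtain z where "t < z" "z < 0" "R t = t * r z" by (auto simp: R_def)
        then show ?thesis using \<open>t < 0\<close> by (intro exI[of _ z]) simp
      qed
      then obtain z where z: "z \<noteq> 0" "\<bar>z\<bar> \<le> \<bar>t\<bar>" "R t = t * r z" by blast
      have "\<bar>R t / t\<^sup>2\<bar> = \<bar>r z\<bar> / \<bar>t\<bar>"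
        using False z by (simp add: abs_divide abs_mult power2_eq_square field_simps)
      also have "\<dots> < e"
        using r_bound[OF z(1,2)] False by (simp add: pos_divide_less_eq)
      finally show ?thesis .
    qed (use \<open>0 < e\<close> in simp)
    then show "eventually (\<lambda>t. dist (R t / t\<^sup>2) 0 < e) (nhds 0)"
      unfolding eventually_nhds_metric by (intro exI[of _ "min d0 d1"]) (use d0 d1 in auto)
  qed
  then show ?thesis by (simp add: R_def)
qed

text \<open>
  Supplies the integrable majorant for differentiating a moment generating function twice.
\<close>

lemma exp_remainder_bounds:
  fixes u :: real
  shows "\<bar>exp u - 1 - u\<bar> \<le> u\<^sup>2 * exp \<bar>u\<bar>"
proof -
  have lower: "0 \<le> exp u - 1 - u" using exp_ge_add_one_self[of u] by linarith
  \<comment> \<open>convexity from the other side: \<open>1 - u \<le> exp (- u)\<close>, multiplied by \<open>exp u\<close>\<close>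
  have "(1 - u) * exp u \<le> exp (- u) * exp u"
    using exp_ge_add_one_self[of "- u"] by (intro mult_right_mono) auto
  then have chord: "exp u - 1 - u \<le> u * (exp u - 1)"
    by (simp add: exp_add[symmetric] algebra_simps)
  have "u * (exp u - 1) \<le> u * (u * exp \<bar>u\<bar>)"
  proof (cases "0 \<le> u")
    case True
    then show ?thesis
      using chord lower by (intro mult_left_mono) (auto simp: algebra_simps)
  next
    case False
    then have "u * (exp u - 1) \<le> u * (u * 1)"
      using lower by (intro mult_left_mono_neg) linarith+
    also have "\<dots> \<le> u * (u * exp \<bar>u\<bar>)"
      using False by (intro mult_left_mono_neg) auto
    finally show ?thesis .
  qed
  with lower chord show ?thesis by (simp add: power2_eq_square mult.assoc)
qed

section \<open>Bregman balls of a convex potential\<close>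

definition bregman :: "(real \<Rightarrow> real) \<Rightarrow> (real \<Rightarrow> real) \<Rightarrow> real \<Rightarrow> real \<Rightarrow> real" where
  "bregman f f' a t = f t - f a - f' a * (t - a)"

text \<open>
  The radius \<open>g\<close> is an extended real, so that the limit of an infinite radius is covered. For \<open>0 \<le> g\<close>
  the centre \<open>a\<close> itself belongs to the set, and the supremum is at least \<open>f' a\<close>.
\<close>

definition upper_end ::
    "real set \<Rightarrow> (real \<Rightarrow> real) \<Rightarrow> (real \<Rightarrow> real) \<Rightarrow> ereal \<Rightarrow> real \<Rightarrow> ereal" where
  "upper_end T f f' g a =
    Sup ((\<lambda>t. ereal (f' t)) ` {t \<in> T. a \<le> t \<and> ereal (bregman f f' a t) \<le> g})"

text \<open>
  Convexity is expressed through the derivative; second derivatives enter only at single points, as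
  hypotheses of the asymptotic statements.
\<close>

locale convex_potential =
  fixes T :: "real set" and f f' :: "real \<Rightarrow> real"
  assumes open_domain: "open T"
    and interval_domain: "is_interval T"
    and deriv_potential: "t \<in> T \<Longrightarrow> (f has_real_derivative f' t) (at t)"
    and deriv_strict_mono: "strict_mono_on T f'"
    and continuous_deriv: "continuous_on T f'"
begin

lemma between_in_domain: "s \<in> T \<Longrightarrow> t \<in> T \<Longrightarrow> s \<le> u \<Longrightarrow> u \<le> t \<Longrightarrow> u \<in> T"
  using interval_domain by (meson is_interval_1)

lemma deriv_less_iff: "s \<in> T \<Longrightarrow> t \<in> T \<Longrightarrow> f' s < f' t \<longleftrightarrow> s < t"
  using deriv_strict_mono by (rule strict_mono_on_less)

lemma deriv_le_iff: "s \<in> T \<Longrightarrow> t \<in> T \<Longrightarrow> f' s \<le> f' t \<longleftrightarrow> s \<le> t"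
  using deriv_less_iff[of t s] by force

lemma isCont_deriv: "t \<in> T \<Longrightarrow> isCont f' t"
  using continuous_deriv open_domain continuous_on_eq_continuous_at by blast

lemma isCont_potential: "t \<in> T \<Longrightarrow> isCont f t"
  using deriv_potential DERIV_isCont by blast

lemma bregman_strict_mono:
  assumes "a \<in> T" "t \<in> T" "a \<le> s" "s < t"
  shows "bregman f f' a s < bregman f f' a t"
proof -
  have "s \<in> T"
    using between_in_domain[OF assms(1,2)] assms by simp
  have "\<exists>z>s. z < t \<and> bregman f f' a t - bregman f f' a s = (t - s) * (f' z - f' a)"
  proof (rule MVT2)
    fix x assume "s \<le> x" "x \<le> t"
    then have "x \<in> T"
      using between_in_domain \<open>s \<in> T\<close> \<open>t \<in> T\<close> by blast
    then show "((\<lambda>t. bregman f f' a t) has_real_derivative f' x - f' a) (at x)"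
      unfolding bregman_def using deriv_potential by (auto intro!: derivative_eq_intros)
  qed (use assms in auto)
  then obtain z where z: "s < z" "z < t"
    and eq: "bregman f f' a t - bregman f f' a s = (t - s) * (f' z - f' a)"
    by blast
  have "z \<in> T" "a < z"
    using between_in_domain[OF \<open>s \<in> T\<close> \<open>t \<in> T\<close>] z assms by auto
  then have "0 < f' z - f' a"
    using deriv_less_iff \<open>a \<in> T\<close> by simp
  then have "0 < (t - s) * (f' z - f' a)"
    using \<open>s < t\<close> by simp
  with eq show ?thesis by simp
qed

lemma bregman_self [simp]: "bregman f f' a a = 0"
  by (simp add: bregman_def)

lemma tendsto_bregman:
  assumes "(a \<longlongrightarrow> a0) F" "a0 \<in> T"
  shows "((\<lambda>x. bregman f f' (a x) t) \<longlongrightarrow> bregman f f' a0 t) F"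
  unfolding bregman_def
  by (intro tendsto_intros isCont_tendsto_compose[OF isCont_deriv[OF assms(2)] assms(1)]
      isCont_tendsto_compose[OF isCont_potential[OF assms(2)] assms(1)] assms(1))

lemma upper_end_ge:
  assumes "t \<in> T" "a \<le> t" "ereal (bregman f f' a t) \<le> g"
  shows "ereal (f' t) \<le> upper_end T f f' g a"
  unfolding upper_end_def by (rule Sup_upper) (use assms in auto)

lemma upper_end_ge_deriv: "a \<in> T \<Longrightarrow> 0 \<le> g \<Longrightarrow> ereal (f' a) \<le> upper_end T f f' g a"
  using upper_end_ge[of a a g] by (simp add: zero_ereal_def)

text \<open>
  The divergence increases away from its base point, so one point violating the constraint
  bounds the whole constraint set.
\<close>

lemma upper_end_le:
  assumes "t \<in> T" "a \<in> T" "a \<le> t" "g < ereal (bregman f f' a t)"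
  shows "upper_end T f f' g a \<le> ereal (f' t)"
  unfolding upper_end_def
proof (rule Sup_least, clarsimp)
  fix s assume s: "s \<in> T" "a \<le> s" "ereal (bregman f f' a s) \<le> g"
  have "\<not> t < s"
  proof
    assume "t < s"
    then have "ereal (bregman f f' a t) < ereal (bregman f f' a s)"
      using bregman_strict_mono[of a s t] assms s by simp
    also have "\<dots> < ereal (bregman f f' a t)" using s(3) assms(4) by (rule le_less_trans)
    finally show False .
  qed
  then show "f' s \<le> f' t"
    using deriv_le_iff s assms by simp
qed

text \<open>
  Continuity can only fail where the divergence is constant, or where it jumps across the radius.
  Strict monotonicity in \<open>t\<close> excludes the first, so points strictly inside the limiting end satisfy
  the constraint with room to spare; continuity in the centre excludes the second. If no point
  violates the limiting constraint, the limiting end is the supremum of all values of \<open>f'\<close>, which no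
  end exceeds.
\<close>

lemma tendsto_upper_end:
  assumes a0: "a0 \<in> T" and a: "(a \<longlongrightarrow> a0) F"
    and g: "(g \<longlongrightarrow> g0) F" and g_nonneg: "eventually (\<lambda>x. 0 \<le> g x) F" and g0: "0 \<le> g0"
  shows "((\<lambda>x. upper_end T f f' (g x) (a x)) \<longlongrightarrow> upper_end T f f' g0 a0) F"
proof -
  have a_in: "eventually (\<lambda>x. a x \<in> T) F"
    using topological_tendstoD[OF a open_domain a0] .
  have breg: "((\<lambda>x. ereal (bregman f f' (a x) t)) \<longlongrightarrow> ereal (bregman f f' a0 t)) F" for t
    using tendsto_bregman[OF a a0] by simp
  define S where "S = upper_end T f f' g0 a0"
  have base: "ereal (f' a0) \<le> S"
    unfolding S_def using upper_end_ge_deriv a0 g0 by blast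
  have lower: "eventually (\<lambda>x. l < upper_end T f f' (g x) (a x)) F" if l: "l < S" for l
  proof -
    obtain t1 where t1: "t1 \<in> T" "a0 \<le> t1" "ereal (bregman f f' a0 t1) \<le> g0" "l < ereal (f' t1)"
      using l unfolding S_def upper_end_def less_Sup_iff by auto
    show ?thesis
    proof (cases "a0 = t1")
      case True
      have "((\<lambda>x. ereal (f' (a x))) \<longlongrightarrow> ereal (f' a0)) F"
        using isCont_tendsto_compose[OF isCont_deriv[OF a0] a] by simp
      then have "eventually (\<lambda>x. l < ereal (f' (a x))) F"
        using t1 True order_tendstoD(1) by blast
      with a_in g_nonneg show ?thesis
        by eventually_elim (rule less_le_trans[OF _ upper_end_ge_deriv])
    next
      case False
      then have "a0 < t1" using t1 by simp
      \<comment> \<open>moving \<open>t1\<close> slightly towards \<open>a0\<close> makes the constraint strict, hence stable under perturbation\<close>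
      have "((\<lambda>t. ereal (f' t)) \<longlongrightarrow> ereal (f' t1)) (at_left t1)"
        using isCont_deriv[OF t1(1)] by (simp add: isCont_def filterlim_at_split)
      then have "eventually (\<lambda>t. l < ereal (f' t)) (at_left t1)"
        using t1 order_tendstoD(1) by blast
      moreover have "eventually (\<lambda>t. a0 < t \<and> t < t1) (at_left t1)"
        using \<open>a0 < t1\<close> by (auto simp: eventually_at_left intro!: exI[of _ a0])
      ultimately have "eventually (\<lambda>t. l < ereal (f' t) \<and> a0 < t \<and> t < t1) (at_left t1)"
        by eventually_elim auto
      then have "\<exists>t. l < ereal (f' t) \<and> a0 < t \<and> t < t1"
        by (rule eventually_happens'[rotated]) simp
      then obtain t where t: "l < ereal (f' t)" "a0 < t" "t < t1"
        by blast
      have tT: "t \<in> T"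
        using between_in_domain[OF a0 t1(1)] t by simp
      have "ereal (bregman f f' a0 t) < ereal (bregman f f' a0 t1)"
        using bregman_strict_mono[OF a0 t1(1), of t] t by simp
      then have "ereal (bregman f f' a0 t) < g0"
        using t1(3) by (rule less_le_trans)
      then have "eventually (\<lambda>x. ereal (bregman f f' (a x) t) < g x) F"
        using breg[of t] g by (rule order_tendsto_less)
      moreover have "eventually (\<lambda>x. a x < t) F"
        using order_tendstoD(2)[OF a t(2)] .
      ultimately show ?thesis
        by eventually_elim (rule less_le_trans[OF t(1) upper_end_ge[OF tT]], simp_all)
    qed
  qed
  have upper: "eventually (\<lambda>x. upper_end T f f' (g x) (a x) < u) F" if u: "S < u" for u
  proof (cases "\<exists>t\<in>T. a0 < t \<and> g0 < ereal (bregman f f' a0 t)")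
    case True
    then obtain t where t: "t \<in> T" "a0 < t" "g0 < ereal (bregman f f' a0 t)" by blast
    \<comment> \<open>if \<open>f' t\<close> is too large, the intermediate value theorem gives a point with value strictly between
      \<open>S\<close> and \<open>u\<close>; its value exceeds \<open>S\<close>, so it violates the constraint as well\<close>
    have "\<exists>s\<in>T. a0 < s \<and> g0 < ereal (bregman f f' a0 s) \<and> ereal (f' s) < u"
    proof (cases "ereal (f' t) < u")
      case False
      obtain v where v: "S < ereal v" "ereal v < u"
        using ereal_dense2 u by blast
      have "ereal (f' a0) < ereal v"
        using base v(1) by (rule le_less_trans)
      moreover have "ereal v < ereal (f' t)"
        using v(2) False by (metis leI less_le_trans)
      ultimately have fv: "f' a0 < v" "v < f' t" by simp_all
      have "\<exists>s. a0 \<le> s \<and> s \<le> t \<and> f' s = v"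
      proof (rule IVT)
        show "\<forall>x. a0 \<le> x \<and> x \<le> t \<longrightarrow> isCont f' x"
          using isCont_deriv between_in_domain[OF a0 t(1)] by blast
      qed (use fv t in auto)
      then obtain s where s: "a0 \<le> s" "s \<le> t" "f' s = v" by blast
      have "s \<in> T"
        using between_in_domain[OF a0 t(1)] s by simp
      moreover have "a0 < s"
        using s fv by (cases "a0 = s") auto
      moreover have "g0 < ereal (bregman f f' a0 s)"
        using upper_end_ge[of s a0 g0] v(1) s \<open>s \<in> T\<close> unfolding S_def by (auto simp flip: not_le)
      ultimately show ?thesis
        using v s by blast
    qed (use t in blast)
    then obtain s where s: "s \<in> T" "a0 < s" "g0 < ereal (bregman f f' a0 s)" "ereal (f' s) < u" by blast
    have "eventually (\<lambda>x. g x < ereal (bregman f f' (a x) s)) F"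
      using s(3) g breg[of s] by (rule order_tendsto_less)
    moreover have "eventually (\<lambda>x. a x < s) F"
      using order_tendstoD(2)[OF a s(2)] .
    ultimately show ?thesis
      using a_in by eventually_elim (rule le_less_trans[OF upper_end_le[OF s(1)] s(4)], simp_all)
  next
    case False
    have "ereal (f' t) \<le> S" if "t \<in> T" for t
    proof (cases "a0 < t")
      case True
      then have "ereal (bregman f f' a0 t) \<le> g0" using False that by (auto simp: not_less)
      then show ?thesis unfolding S_def using True that upper_end_ge by simp
    next
      case False
      then have "ereal (f' t) \<le> ereal (f' a0)" using deriv_le_iff[OF that a0] by simp
      then show ?thesis using base by (rule order_trans)
    qed
    then have "upper_end T f f' (g x) (a x) \<le> S" for x
      unfolding upper_end_def[of _ _ _ "g x"] by (auto intro!: Sup_least)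
    then show ?thesis
      using u by (intro always_eventually) (auto intro: le_less_trans)
  qed
  show ?thesis
    using lower upper unfolding S_def by (intro order_tendstoI)
qed


text \<open>
  The Bregman divergence is linear in the potential. On the quadratic part \<open>v t\<^sup>2 / 2\<close> it equals
  \<open>v (w - u)\<^sup>2 / 2\<close> with increments \<open>u = a x - a0\<close> and \<open>w = c * e x\<close>, and on the Taylor remainder it is
  \<open>o(e\<^sup>2)\<close>. A centre within \<open>o(e)\<close> of \<open>a0\<close> does not change the limit.
\<close>

lemma bregman_asymptotics:
  assumes a0: "a0 \<in> T" and v: "(f' has_real_derivative v) (at a0)"
    and e: "(e \<longlongrightarrow> 0) F" and e_pos: "eventually (\<lambda>x. 0 < e x) F"
    and a: "((\<lambda>x. (a x - a0) / e x) \<longlongrightarrow> 0) F"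
  shows "((\<lambda>x. bregman f f' (a x) (a0 + c * e x) / (e x)\<^sup>2) \<longlongrightarrow> v * c\<^sup>2 / 2) F"
proof -
  define R where "R t = f (a0 + t) - f a0 - f' a0 * t - v * t\<^sup>2 / 2" for t
  define r where "r t = f' (a0 + t) - f' a0 - v * t" for t
  have R: "((\<lambda>t. R t / t\<^sup>2) \<longlongrightarrow> 0) (nhds 0)"
    unfolding R_def by (rule second_order_remainder[OF open_domain a0 deriv_potential v])
  have r: "((\<lambda>t. r t / t) \<longlongrightarrow> 0) (nhds 0)"
    unfolding r_def by (rule first_order_remainder[OF v])
  define s where "s x = (a x - a0) / e x" for x
  have s: "(s \<longlongrightarrow> 0) F" unfolding s_def using a .
  have lim0: "((\<lambda>x. y x * e x) \<longlongrightarrow> 0) F" if "(y \<longlongrightarrow> y0) F" for y y0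
    using tendsto_mult[OF that e] by simp
  have R_lim: "((\<lambda>x. (y x)\<^sup>2 * (R (y x * e x) / (y x * e x)\<^sup>2)) \<longlongrightarrow> 0) F" if "(y \<longlongrightarrow> y0) F" for y y0
    using tendsto_mult[OF tendsto_power[OF that, of 2] filterlim_compose[OF R lim0[OF that]]] by simp
  have r_lim: "((\<lambda>x. s x * (r (s x * e x) / (s x * e x))) \<longlongrightarrow> 0) F"
    using tendsto_mult[OF s filterlim_compose[OF r lim0[OF s]]] by simp
  have "((\<lambda>x. v * (c - s x)\<^sup>2 / 2 + c\<^sup>2 * (R (c * e x) / (c * e x)\<^sup>2)
      - (s x)\<^sup>2 * (R (s x * e x) / (s x * e x)\<^sup>2)
      - s x * (r (s x * e x) / (s x * e x)) * (c - s x)) \<longlongrightarrow>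
      v * (c - 0)\<^sup>2 / 2 + 0 - 0 - 0 * (c - 0)) F"
    by (intro tendsto_intros s R_lim[OF s] R_lim[OF tendsto_const] r_lim) simp
  then have "((\<lambda>x. v * (c - s x)\<^sup>2 / 2 + c\<^sup>2 * (R (c * e x) / (c * e x)\<^sup>2)
      - (s x)\<^sup>2 * (R (s x * e x) / (s x * e x)\<^sup>2)
      - s x * (r (s x * e x) / (s x * e x)) * (c - s x)) \<longlongrightarrow> v * c\<^sup>2 / 2) F"
    by simp
  then show ?thesis
  proof (rule Lim_transform_eventually)
    from e_pos show "eventually (\<lambda>x. v * (c - s x)\<^sup>2 / 2 + c\<^sup>2 * (R (c * e x) / (c * e x)\<^sup>2)
      - (s x)\<^sup>2 * (R (s x * e x) / (s x * e x)\<^sup>2)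
      - s x * (r (s x * e x) / (s x * e x)) * (c - s x) =
      bregman f f' (a x) (a0 + c * e x) / (e x)\<^sup>2) F"
    proof eventually_elim
      case (elim x)
      define w where "w = c * e x"
      define u where "u = s x * e x"
      have ax: "a x = a0 + u" using elim by (simp add: u_def s_def)
      have R0: "R 0 = 0" and r0: "r 0 = 0" by (simp_all add: R_def r_def)
      have "c\<^sup>2 * (R (c * e x) / (c * e x)\<^sup>2) = R w / (e x)\<^sup>2"
        using elim R0 by (cases "c = 0") (auto simp: w_def power_mult_distrib)
      moreover have "(s x)\<^sup>2 * (R (s x * e x) / (s x * e x)\<^sup>2) = R u / (e x)\<^sup>2"
        using elim R0 by (cases "s x = 0") (auto simp: u_def power_mult_distrib)
      moreover have "s x * (r (s x * e x) / (s x * e x)) * (c - s x) = r u * (w - u) / (e x)\<^sup>2"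
        using elim r0 by (cases "s x = 0") (auto simp: u_def w_def power2_eq_square field_simps)
      moreover have "v * (c - s x)\<^sup>2 / 2 = (v * (w - u)\<^sup>2 / 2) / (e x)\<^sup>2"
        using elim by (simp add: u_def w_def power2_eq_square field_simps)
      moreover have "bregman f f' (a x) (a0 + c * e x) = v * (w - u)\<^sup>2 / 2 + R w - R u - r u * (w - u)"
        unfolding bregman_def ax w_def[symmetric] R_def r_def by (simp add: power2_eq_square algebra_simps add_divide_distrib diff_divide_distrib)
      ultimately show ?case
        by (simp add: add_divide_distrib diff_divide_distrib)
    qed
  qed
qed

text \<open>
  Test points \<open>a0 + c e\<close>: by the quadratic expansion they eventually satisfy the constraint when
  \<open>v c\<^sup>2 / 2 < 1\<close> and violate it when \<open>v c\<^sup>2 / 2 > 1\<close>, so the end lies at \<open>c0 = sqrt (2 / v)\<close> to first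
  order, and \<open>f'\<close> has slope \<open>v\<close> there.
\<close>

lemma upper_end_asymptotics:
  assumes a0: "a0 \<in> T" and v: "(f' has_real_derivative v) (at a0)" and v_pos: "0 < v"
    and e: "(e \<longlongrightarrow> 0) F" and e_pos: "eventually (\<lambda>x. 0 < e x) F"
    and a: "((\<lambda>x. (a x - a0) / e x) \<longlongrightarrow> 0) F"
    and g: "((\<lambda>x. g x / (e x)\<^sup>2) \<longlongrightarrow> 1) F"
  shows "((\<lambda>x. (upper_end T f f' (ereal (g x)) (a x) - ereal (f' a0)) / ereal (e x)) \<longlongrightarrow>
    ereal (sqrt (2 * v))) F"
proof -
  define c0 where "c0 = sqrt (2 / v)"
  have c0: "0 < c0" "v * c0 = sqrt (2 * v)" "v * c0\<^sup>2 / 2 = 1"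
    using v_pos by (auto simp: c0_def real_sqrt_divide real_sqrt_mult real_div_sqrt field_simps)
  have a_lim: "(a \<longlongrightarrow> a0) F"
  proof -
    have "((\<lambda>x. (a x - a0) / e x * e x + a0) \<longlongrightarrow> 0 * 0 + a0) F"
      by (intro tendsto_intros a e)
    then have "((\<lambda>x. (a x - a0) / e x * e x + a0) \<longlongrightarrow> a0) F" by simp
    then show ?thesis
      by (rule Lim_transform_eventually) (use e_pos in eventually_elim, simp)
  qed
  have a_in: "eventually (\<lambda>x. a x \<in> T) F"
    using topological_tendstoD[OF a_lim open_domain a0] .
  have t_in: "eventually (\<lambda>x. a0 + c * e x \<in> T) F" for c
    by (rule topological_tendstoD[OF _ open_domain a0]) (auto intro!: tendsto_eq_intros e)
  have a_less: "eventually (\<lambda>x. a x < a0 + c * e x) F" if "0 < c" for c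
    using order_tendstoD(2)[OF a that] e_pos by eventually_elim (simp add: pos_divide_less_eq)
  have slope: "((\<lambda>x. (f' (a0 + c * e x) - f' a0) / e x) \<longlongrightarrow> v * c) F" if "c \<noteq> 0" for c
  proof -
    have "((\<lambda>x. c * e x) \<longlongrightarrow> 0) F" by (auto intro!: tendsto_eq_intros e)
    from tendsto_mult[OF tendsto_const[of c] filterlim_compose[OF first_order_remainder[OF v] this]]
    have "((\<lambda>x. c * ((f' (a0 + c * e x) - f' a0 - v * (c * e x)) / (c * e x)) + v * c) \<longlongrightarrow> 0 + v * c) F"
      by (intro tendsto_add) auto
    then have "((\<lambda>x. c * ((f' (a0 + c * e x) - f' a0 - v * (c * e x)) / (c * e x)) + v * c) \<longlongrightarrow> v * c) F"
      by simp
    then show ?thesis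
      by (rule Lim_transform_eventually) (use e_pos in eventually_elim, use that in \<open>simp add: field_simps\<close>)
  qed
  note breg = bregman_asymptotics[OF a0 v e e_pos a]
  show ?thesis
  proof (rule order_tendstoI)
    fix l assume l: "l < ereal (sqrt (2 * v))"
    obtain c where c: "0 < c" "c < c0" "l < ereal (v * c)"
    proof -
      have "((\<lambda>c. ereal (v * c)) \<longlongrightarrow> ereal (v * c0)) (at_left c0)"
        by (auto intro!: tendsto_intros)
      then have "eventually (\<lambda>c. l < ereal (v * c)) (at_left c0)"
        using l c0(2) order_tendstoD(1) by metis
      moreover have "eventually (\<lambda>c. 0 < c \<and> c < c0) (at_left c0)"
        using c0(1) by (auto simp: eventually_at_left intro!: exI[of _ 0])
      ultimately have "eventually (\<lambda>c. 0 < c \<and> c < c0 \<and> l < ereal (v * c)) (at_left c0)"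
        by eventually_elim auto
      then have "\<exists>c. 0 < c \<and> c < c0 \<and> l < ereal (v * c)"
        by (rule eventually_happens'[rotated]) simp
      then show ?thesis
        using that by blast
    qed
    have "c\<^sup>2 < c0\<^sup>2" using c by (simp add: power_strict_mono)
    then have "v * c\<^sup>2 / 2 < 1" using v_pos c0(3) by (smt (verit) divide_strict_right_mono mult_strict_left_mono)
    then have "eventually (\<lambda>x. bregman f f' (a x) (a0 + c * e x) / (e x)\<^sup>2 < g x / (e x)\<^sup>2) F"
      using breg g by (rule order_tendsto_less)
    moreover have "eventually (\<lambda>x. l < ereal ((f' (a0 + c * e x) - f' a0) / e x)) F"
      using slope[of c] c order_tendstoD(1)[OF tendsto_ereal] by blast
    ultimately show "eventually (\<lambda>x. l < (upper_end T f f' (ereal (g x)) (a x) - ereal (f' a0)) / ereal (e x)) F"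
      using e_pos t_in[of c] a_less[OF c(1)]
    proof eventually_elim
      case (elim x)
      then have "ereal (f' (a0 + c * e x)) \<le> upper_end T f f' (ereal (g x)) (a x)"
        by (intro upper_end_ge) (auto simp: divide_less_cancel)
      then have "ereal (f' (a0 + c * e x)) - ereal (f' a0) \<le> upper_end T f f' (ereal (g x)) (a x) - ereal (f' a0)"
        by (intro ereal_minus_mono) auto
      then have "(ereal (f' (a0 + c * e x)) - ereal (f' a0)) / ereal (e x)
          \<le> (upper_end T f f' (ereal (g x)) (a x) - ereal (f' a0)) / ereal (e x)"
        using elim by (intro ereal_divide_right_mono) auto
      with elim show ?case by auto
    qed
  next
    fix u assume u: "ereal (sqrt (2 * v)) < u"
    obtain c where c: "c0 < c" "ereal (v * c) < u"
    proof -
      have "((\<lambda>c. ereal (v * c)) \<longlongrightarrow> ereal (v * c0)) (at_right c0)"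
        by (auto intro!: tendsto_intros)
      then have "eventually (\<lambda>c. ereal (v * c) < u) (at_right c0)"
        using u c0(2) order_tendstoD(2) by metis
      moreover have "eventually (\<lambda>c. c0 < c) (at_right c0)"
        by (rule eventually_at_right_less)
      ultimately have "eventually (\<lambda>c. c0 < c \<and> ereal (v * c) < u) (at_right c0)"
        by eventually_elim auto
      then have "\<exists>c. c0 < c \<and> ereal (v * c) < u"
        by (rule eventually_happens'[rotated]) simp
      then show ?thesis
        using that by blast
    qed
    have "0 < c" using c c0 by simp
    have "c0\<^sup>2 < c\<^sup>2" using c c0 by (simp add: power_strict_mono)
    then have "1 < v * c\<^sup>2 / 2" using v_pos c0(3) by (smt (verit) divide_strict_right_mono mult_strict_left_mono)
    then have "eventually (\<lambda>x. g x / (e x)\<^sup>2 < bregman f f' (a x) (a0 + c * e x) / (e x)\<^sup>2) F"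
      using g breg by (rule order_tendsto_less)
    moreover have "eventually (\<lambda>x. ereal ((f' (a0 + c * e x) - f' a0) / e x) < u) F"
      using slope[of c] c \<open>0 < c\<close> order_tendstoD(2)[OF tendsto_ereal] by blast
    ultimately show "eventually (\<lambda>x. (upper_end T f f' (ereal (g x)) (a x) - ereal (f' a0)) / ereal (e x) < u) F"
      using e_pos t_in[of c] a_less[OF \<open>0 < c\<close>] a_in
    proof eventually_elim
      case (elim x)
      then have "upper_end T f f' (ereal (g x)) (a x) \<le> ereal (f' (a0 + c * e x))"
        by (intro upper_end_le) (auto simp: divide_less_cancel)
      then have "upper_end T f f' (ereal (g x)) (a x) - ereal (f' a0) \<le> ereal (f' (a0 + c * e x)) - ereal (f' a0)"
        by (intro ereal_minus_mono) auto
      then have "(upper_end T f f' (ereal (g x)) (a x) - ereal (f' a0)) / ereal (e x)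
          \<le> (ereal (f' (a0 + c * e x)) - ereal (f' a0)) / ereal (e x)"
        using elim by (intro ereal_divide_right_mono) auto
      with elim show ?case by auto
    qed
  qed
qed

text \<open>Lets every statement on lower ends be read off from the one on upper ends.\<close>

lemma reflected: "convex_potential (uminus ` T) (\<lambda>t. f (- t)) (\<lambda>t. - f' (- t))"
proof
  show "open (uminus ` T)" using open_domain by (rule open_negations)
  show "is_interval (uminus ` T)" using interval_domain by simp
  show "((\<lambda>t. f (- t)) has_real_derivative - f' (- t)) (at t)" if "t \<in> uminus ` T" for t
  proof -
    have "(f has_real_derivative f' (- t)) (at (- t))" using that deriv_potential by auto
    then show ?thesis by (simp add: DERIV_mirror)
  qed
  show "strict_mono_on (uminus ` T) (\<lambda>t. - f' (- t))"
    using deriv_less_iff by (auto intro!: strict_mono_onI)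
  show "continuous_on (uminus ` T) (\<lambda>t. - f' (- t))"
    by (intro continuous_intros continuous_on_compose2[OF continuous_deriv]) auto
qed

end

definition lower_end ::
    "real set \<Rightarrow> (real \<Rightarrow> real) \<Rightarrow> (real \<Rightarrow> real) \<Rightarrow> ereal \<Rightarrow> real \<Rightarrow> ereal" where
  "lower_end T f f' g a =
    Inf ((\<lambda>t. ereal (f' t)) ` {t \<in> T. t \<le> a \<and> ereal (bregman f f' a t) \<le> g})"

lemma lower_end_eq_reflected_upper_end:
  "lower_end T f f' g a = - upper_end (uminus ` T) (\<lambda>t. f (- t)) (\<lambda>t. - f' (- t)) g (- a)"
proof -
  have breg: "bregman (\<lambda>t. f (- t)) (\<lambda>t. - f' (- t)) (- a) (- t) = bregman f f' a t" for t
    by (simp add: bregman_def algebra_simps)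
  have "{t \<in> uminus ` T. - a \<le> t \<and> ereal (bregman (\<lambda>t. f (- t)) (\<lambda>t. - f' (- t)) (- a) t) \<le> g}
      = uminus ` {t \<in> T. t \<le> a \<and> ereal (bregman f f' a t) \<le> g}"
    by (auto simp: breg)
  then have "upper_end (uminus ` T) (\<lambda>t. f (- t)) (\<lambda>t. - f' (- t)) g (- a)
      = Sup (uminus ` (\<lambda>t. ereal (f' t)) ` {t \<in> T. t \<le> a \<and> ereal (bregman f f' a t) \<le> g})"
    unfolding upper_end_def by (simp add: image_image)
  then show ?thesis
    unfolding lower_end_def ereal_Sup_uminus_image_eq by simp
qed

context convex_potential
begin

lemma lower_end_le_deriv: "a \<in> T \<Longrightarrow> 0 \<le> g \<Longrightarrow> lower_end T f f' g a \<le> ereal (f' a)"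
  unfolding lower_end_def by (intro Inf_lower image_eqI[where x = a]) (simp_all add: zero_ereal_def)

lemma tendsto_lower_end:
  assumes a0: "a0 \<in> T" and a: "(a \<longlongrightarrow> a0) F"
    and g: "(g \<longlongrightarrow> g0) F" and g_nonneg: "eventually (\<lambda>x. 0 \<le> g x) F" and g0: "0 \<le> g0"
  shows "((\<lambda>x. lower_end T f f' (g x) (a x)) \<longlongrightarrow> lower_end T f f' g0 a0) F"
proof -
  have "- a0 \<in> uminus ` T" using a0 by simp
  from tendsto_uminus_ereal[OF convex_potential.tendsto_upper_end[OF reflected this tendsto_minus[OF a] g g_nonneg g0]]
  show ?thesis unfolding lower_end_eq_reflected_upper_end .
qed

lemma lower_end_asymptotics:
  assumes a0: "a0 \<in> T" and v: "(f' has_real_derivative v) (at a0)" and v_pos: "0 < v"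
    and e: "(e \<longlongrightarrow> 0) F" and e_pos: "eventually (\<lambda>x. 0 < e x) F"
    and a: "((\<lambda>x. (a x - a0) / e x) \<longlongrightarrow> 0) F"
    and g: "((\<lambda>x. g x / (e x)\<^sup>2) \<longlongrightarrow> 1) F"
  shows "((\<lambda>x. (ereal (f' a0) - lower_end T f f' (ereal (g x)) (a x)) / ereal (e x)) \<longlongrightarrow>
    ereal (sqrt (2 * v))) F"
proof -
  have "((\<lambda>x. (- a x - - a0) / e x) \<longlongrightarrow> 0) F"
    using tendsto_minus[OF a] by (simp add: minus_divide_left del: minus_divide_left[symmetric])
  moreover have "((\<lambda>t. - f' (- t)) has_real_derivative v) (at (- a0))"
    using v DERIV_mirror[of f' "- v" "a0"] by (auto intro!: derivative_eq_intros simp: DERIV_mirror)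
  ultimately have "((\<lambda>x. (upper_end (uminus ` T) (\<lambda>t. f (- t)) (\<lambda>t. - f' (- t)) (ereal (g x)) (- a x)
      - ereal (- f' (- (- a0)))) / ereal (e x)) \<longlongrightarrow> ereal (sqrt (2 * v))) F"
    using convex_potential.upper_end_asymptotics[OF reflected, of "- a0" v e F "\<lambda>x. - a x" g]
      a0 v_pos e e_pos g by auto
  moreover have "U - ereal (- f' (- (- a0))) = ereal (f' a0) - (- U)" for U
    by (cases U) auto
  ultimately show ?thesis
    unfolding lower_end_eq_reflected_upper_end by simp
qed

end

section \<open>Mean and variance in an exponential family\<close>

text \<open>
  Jensen's inequality, by integrating the tangent to \<open>x \<mapsto> exp (t * x)\<close> at the mean. It is stated for the
  nonnegative integral, since the moment generating function may be infinite.
\<close>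

lemma exp_mean_le_mgf:
  assumes "prob_space \<nu>" and sets: "sets \<nu> = sets borel" and int: "integrable \<nu> (\<lambda>x. x)"
  shows "ennreal (exp (t * dist_mean \<nu>)) \<le> (\<integral>\<^sup>+x. ennreal (exp (t * x)) \<partial>\<nu>)"
proof -
  interpret prob_space \<nu> by fact
  have [measurable]: "(\<lambda>x. exp (t * x)) \<in> borel_measurable \<nu>"
    by (simp add: measurable_cong_sets[OF sets])
  define m where "m = dist_mean \<nu>"
  show ?thesis
  proof (cases "(\<integral>\<^sup>+x. ennreal (exp (t * x)) \<partial>\<nu>) < \<infinity>")
    case True
    then have exp_int: "integrable \<nu> (\<lambda>x. exp (t * x))"
      by (intro integrableI_nonneg) auto
    have tangent: "exp (t * m) * (1 + t * (x - m)) \<le> exp (t * x)" for x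
    proof -
      have "exp (t * m) * (1 + t * (x - m)) \<le> exp (t * m) * exp (t * (x - m))"
        by (intro mult_left_mono exp_ge_add_one_self) simp
      then show ?thesis by (simp add: exp_add[symmetric] algebra_simps)
    qed
    have "exp (t * m) = (\<integral>x. exp (t * m) * (1 + t * (x - m)) \<partial>\<nu>)"
      using int by (simp add: prob_space m_def dist_mean_def)
    also have "\<dots> \<le> (\<integral>x. exp (t * x) \<partial>\<nu>)"
      using int exp_int tangent by (intro integral_mono) auto
    finally show ?thesis
      using exp_int by (subst nn_integral_eq_integral) (auto simp: m_def ennreal_leI)
  qed (simp add: top.not_eq_extremum[symmetric] infinity_ennreal_def)
qed

lemma mean_le_log_mgf:
  assumes "prob_space \<nu>" "sets \<nu> = sets borel" "integrable \<nu> (\<lambda>x. x)"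
  shows "ereal (t * dist_mean \<nu>) \<le> log_mgf \<nu> t"
proof (cases "(\<integral>\<^sup>+x. ennreal (exp (t * x)) \<partial>\<nu>)")
  case (real r)
  have "exp (t * dist_mean \<nu>) \<le> r"
    using exp_mean_le_mgf[OF assms, of t] real by simp
  moreover from this have "0 < r"
    by (rule less_le_trans[rotated]) simp
  ultimately have "t * dist_mean \<nu> \<le> ln r"
    by (simp add: ln_ge_iff)
  with real show ?thesis by (simp add: log_mgf_def)
qed (simp add: log_mgf_def)

lemma log_mgf_0: "prob_space \<nu> \<Longrightarrow> log_mgf \<nu> 0 = 0"
  by (simp add: log_mgf_def prob_space.emeasure_space_1 zero_ereal_def)

context exp_family
begin

abbreviation "\<Theta> \<equiv> nat_params \<xi>"
abbreviation "P \<equiv> exp_dist \<xi> b"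

lemma sets_exp_dist [simp, measurable_cong]: "sets (P \<theta>) = sets borel"
  by (simp add: exp_dist_def sets_ref)

lemma space_exp_dist [simp]: "space (P \<theta>) = UNIV"
  using sets_eq_imp_space_eq[OF sets_exp_dist] by simp

lemma measurable_ref [simp]: "measurable \<xi> M = measurable borel M"
  by (rule measurable_cong_sets[OF sets_ref refl])

text \<open>
  Members of the family are exponential tilts of each other. This transports integrals between
  parameters without returning to the reference measure.
\<close>

lemma exp_dist_change_param:
  "P t = density (P s) (\<lambda>x. ennreal (exp ((t - s) * x - (b t - b s))))"
  unfolding exp_dist_def
  by (subst density_density_eq)
    (auto intro!: arg_cong2[where f = density] simp: ennreal_mult[symmetric] exp_add[symmetric] algebra_simps)

lemma nn_integral_exp_change_param:
  "(\<integral>\<^sup>+x. ennreal (exp (u * x)) \<partial>P t)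
    = ennreal (exp (b s - b t)) * (\<integral>\<^sup>+x. ennreal (exp ((u + t - s) * x)) \<partial>P s)"
proof -
  have "(\<integral>\<^sup>+x. ennreal (exp (u * x)) \<partial>P t)
    = (\<integral>\<^sup>+x. ennreal (exp ((t - s) * x - (b t - b s))) * ennreal (exp (u * x)) \<partial>P s)"
    by (subst exp_dist_change_param[of t s], subst nn_integral_density) auto
  also have "\<dots> = (\<integral>\<^sup>+x. ennreal (exp (b s - b t)) * ennreal (exp ((u + t - s) * x)) \<partial>P s)"
    by (intro nn_integral_cong) (simp add: ennreal_mult[symmetric] exp_add[symmetric] algebra_simps)
  also have "\<dots> = ennreal (exp (b s - b t)) * (\<integral>\<^sup>+x. ennreal (exp ((u + t - s) * x)) \<partial>P s)"
    by (rule nn_integral_cmult) auto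
  finally show ?thesis .
qed

lemma integrable_id:
  assumes "\<theta> \<in> \<Theta>"
  shows "integrable (P \<theta>) (\<lambda>x. x)"
proof -
  have "(\<integral>\<^sup>+x. ennreal \<bar>x\<bar> \<partial>P \<theta>) = (\<integral>\<^sup>+x. ennreal (exp (- b \<theta>)) * ennreal (\<bar>x\<bar> * exp (\<theta> * x)) \<partial>\<xi>)"
    unfolding exp_dist_def
    by (subst nn_integral_density)
      (auto intro!: nn_integral_cong simp: ennreal_mult[symmetric] exp_diff exp_minus field_simps)
  also have "\<dots> = ennreal (exp (- b \<theta>)) * (\<integral>\<^sup>+x. ennreal (\<bar>x\<bar> * exp (\<theta> * x)) \<partial>\<xi>)"
    by (rule nn_integral_cmult) auto
  also have "\<dots> < \<infinity>"
    using assms by (simp add: nat_params_def ennreal_mult_less_top)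
  finally show ?thesis
    by (intro integrableI_bounded) auto
qed

text \<open>
  The identity holds for all real \<open>t\<close> and \<open>u\<close>, with both sides possibly infinite. The hypothesis
  on \<open>s\<close> makes the moment generating function of \<open>P s\<close> positive, so that the junk value \<open>ln 0\<close> cannot
  arise.
\<close>

lemma log_mgf_change_param:
  assumes s: "s \<in> \<Theta>"
  shows "log_mgf (P t) u = log_mgf (P s) (u + t - s) + ereal (b s - b t)"
proof -
  let ?I = "\<integral>\<^sup>+x. ennreal (exp ((u + t - s) * x)) \<partial>P s"
  have pos: "0 < ?I"
    using exp_mean_le_mgf[OF prob_exp_dist[OF s] sets_exp_dist integrable_id[OF s], of "u + t - s"]
    by (rule less_le_trans[rotated]) simp
  note eq = nn_integral_exp_change_param[where u = u and t = t and s = s]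
  show ?thesis
  proof (cases ?I)
    case (real r)
    with pos have "0 < r" by simp
    have "(\<integral>\<^sup>+x. ennreal (exp (u * x)) \<partial>P t) = ennreal (exp (b s - b t) * r)"
      unfolding eq real by (simp add: ennreal_mult[symmetric] \<open>0 \<le> r\<close>)
    then show ?thesis
      unfolding log_mgf_def real using \<open>0 < r\<close> by (simp add: ln_mult)
  next
    case top
    then have "(\<integral>\<^sup>+x. ennreal (exp (u * x)) \<partial>P t) = \<infinity>"
      unfolding eq by (simp add: ennreal_mult_top)
    then show ?thesis
      unfolding log_mgf_def top by simp
  qed
qed

lemma log_mgf_exp_dist:
  assumes "\<theta> + t \<in> \<Theta>"
  shows "log_mgf (P \<theta>) t = ereal (b (\<theta> + t) - b \<theta>)"
  using log_mgf_change_param[OF assms, of \<theta> t] log_mgf_0[OF prob_exp_dist[OF assms]] by simp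

lemma exp_integral_exp_dist:
  assumes "\<theta> + t \<in> \<Theta>"
  shows "integrable (P \<theta>) (\<lambda>x. exp (t * x))"
    and "(\<integral>x. exp (t * x) \<partial>P \<theta>) = exp (b (\<theta> + t) - b \<theta>)"
proof -
  interpret prob_space "P (\<theta> + t)" using assms by (rule prob_exp_dist)
  have eq: "(\<integral>\<^sup>+x. ennreal (exp (t * x)) \<partial>P \<theta>) = ennreal (exp (b (\<theta> + t) - b \<theta>))"
    using nn_integral_exp_change_param[where u = t and t = \<theta> and s = "\<theta> + t"] emeasure_space_1 by simp
  show int: "integrable (P \<theta>) (\<lambda>x. exp (t * x))"
    by (rule integrableI_nonneg) (auto simp: eq)
  show "(\<integral>x. exp (t * x) \<partial>P \<theta>) = exp (b (\<theta> + t) - b \<theta>)"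
    by (subst integral_eq_nn_integral) (auto simp: eq)
qed

lemma b_deriv: "\<theta> \<in> \<Theta> \<Longrightarrow> (b has_real_derivative deriv b \<theta>) (at \<theta>)"
  using b_differentiable DERIV_deriv_iff_real_differentiable by blast

lemma b_deriv2: "\<theta> \<in> \<Theta> \<Longrightarrow> (deriv b has_real_derivative deriv (deriv b) \<theta>) (at \<theta>)"
  using b_twice_differentiable DERIV_deriv_iff_real_differentiable by blast

lemma params_nbhd:
  assumes "\<theta> \<in> \<Theta>"
  obtains r where "0 < r" "\<And>t. \<bar>t\<bar> \<le> r \<Longrightarrow> \<theta> + t \<in> \<Theta>"
proof -
  obtain r where "0 < r" "cball \<theta> r \<subseteq> \<Theta>"
    using assms open_params open_contains_cball by blast
  then show ?thesis
    by (intro that[of r]) (auto simp: dist_real_def subset_iff)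
qed

text \<open>
  By Jensen's inequality \<open>b (\<theta> + t) - b \<theta> \<ge> t m\<close> near \<open>t = 0\<close>, where \<open>m\<close> is the mean, with equality
  at \<open>0\<close>. As \<open>b\<close> is differentiable, the slope of this supporting line is the derivative.
\<close>

lemma mean_exp_dist:
  assumes "\<theta> \<in> \<Theta>"
  shows "dist_mean (P \<theta>) = deriv b \<theta>"
proof -
  obtain r where r: "0 < r" "\<And>t. \<bar>t\<bar> \<le> r \<Longrightarrow> \<theta> + t \<in> \<Theta>"
    using params_nbhd[OF assms] by blast
  let ?g = "\<lambda>s. b s - b \<theta> - (s - \<theta>) * dist_mean (P \<theta>)"
  have min: "?g \<theta> \<le> ?g s" if "\<bar>\<theta> - s\<bar> < r" for s
    using mean_le_log_mgf[OF prob_exp_dist[OF assms] sets_exp_dist integrable_id[OF assms], of "s - \<theta>"]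
      log_mgf_exp_dist[of \<theta> "s - \<theta>"] r(2)[of "s - \<theta>"] that by simp
  have "(?g has_real_derivative deriv b \<theta> - dist_mean (P \<theta>)) (at \<theta>)"
    using b_deriv[OF assms] by (auto intro!: derivative_eq_intros)
  from DERIV_local_min[OF this r(1)] min show ?thesis by simp
qed

text \<open>
  \<open>y\<^sup>2\<close> is absorbed by one factor \<open>exp (r \<bar>y\<bar>)\<close>, and \<open>exp (2 r \<bar>y\<bar>)\<close> is at most the sum of the two
  exponentials with rates \<open>2 r\<close> and \<open>- 2 r\<close>, which lie inside the parameter set.
\<close>

lemma integrable_square_exp:
  assumes r: "\<And>t. \<bar>t\<bar> \<le> 2 * r \<Longrightarrow> \<theta> + t \<in> \<Theta>" "0 < r"
  shows "integrable (P \<theta>) (\<lambda>x. (x - m)\<^sup>2 * exp (r * \<bar>x - m\<bar>))"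
proof (rule Bochner_Integration.integrable_bound)
  show "integrable (P \<theta>) (\<lambda>x. 2 / r\<^sup>2 * (exp (- (2 * r) * m) * exp ((2 * r) * x) + exp (2 * r * m) * exp ((- 2 * r) * x)))"
    using r(2) by (intro integrable_mult_right Bochner_Integration.integrable_add exp_integral_exp_dist(1) r(1)) auto
  have "(x - m)\<^sup>2 * exp (r * \<bar>x - m\<bar>)
      \<le> 2 / r\<^sup>2 * (exp (- (2 * r) * m) * exp ((2 * r) * x) + exp (2 * r * m) * exp ((- 2 * r) * x))" for x
  proof -
    let ?y = "x - m"
    have "(r * \<bar>?y\<bar>)\<^sup>2 / 2 \<le> exp (r * \<bar>?y\<bar>)"
      using exp_lower_Taylor_quadratic[of "r * \<bar>?y\<bar>"] r(2) by (smt (verit) abs_ge_zero mult_nonneg_nonneg)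
    then have "?y\<^sup>2 \<le> 2 / r\<^sup>2 * exp (r * \<bar>?y\<bar>)"
      using r(2) by (simp add: power_mult_distrib field_simps)
    then have "?y\<^sup>2 * exp (r * \<bar>?y\<bar>) \<le> 2 / r\<^sup>2 * exp (r * \<bar>?y\<bar>) * exp (r * \<bar>?y\<bar>)"
      by (intro mult_right_mono) auto
    also have "\<dots> = 2 / r\<^sup>2 * exp (2 * r * \<bar>?y\<bar>)"
      by (simp add: exp_add[symmetric])
    also have "\<dots> \<le> 2 / r\<^sup>2 * (exp (2 * r * ?y) + exp (2 * r * (- ?y)))"
      by (intro mult_left_mono) (auto simp: abs_if)
    also have "\<dots> = 2 / r\<^sup>2 * (exp (- (2 * r) * m) * exp ((2 * r) * x) + exp (2 * r * m) * exp ((- 2 * r) * x))"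
      by (simp add: exp_add[symmetric] algebra_simps)
    finally show ?thesis .
  qed
  then show "AE x in P \<theta>. norm ((x - m)\<^sup>2 * exp (r * \<bar>x - m\<bar>))
      \<le> norm (2 / r\<^sup>2 * (exp (- (2 * r) * m) * exp ((2 * r) * x) + exp (2 * r * m) * exp ((- 2 * r) * x)))"
    by (intro AE_I2) (smt (verit) real_norm_def zero_le_power2 exp_ge_zero mult_nonneg_nonneg)
qed auto

text \<open>
  The quotient \<open>(exp (t y) - 1 - t y) / t\<^sup>2\<close> at \<open>y = x - m\<close> tends to \<open>y\<^sup>2 / 2\<close> as \<open>t \<rightarrow> 0\<close>. Dominated
  convergence gives half the variance. On the other hand the integral is \<open>(h (\<theta> + t) - 1) / t\<^sup>2\<close> with
  \<open>h\<close> the exponential of the centred log-normaliser, whose second derivative at \<open>\<theta>\<close> is that of \<open>b\<close>.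
\<close>

lemma variance_exp_dist:
  assumes "\<theta> \<in> \<Theta>"
  shows "(\<integral>x. (x - dist_mean (P \<theta>))\<^sup>2 \<partial>P \<theta>) = deriv (deriv b) \<theta>"
    and "integrable (P \<theta>) (\<lambda>x. (x - dist_mean (P \<theta>))\<^sup>2)"
proof -
  interpret prob_space "P \<theta>" using assms by (rule prob_exp_dist)
  define m where "m = dist_mean (P \<theta>)"
  define v where "v = deriv (deriv b) \<theta>"
  obtain r0 where r0: "0 < r0" "\<And>t. \<bar>t\<bar> \<le> r0 \<Longrightarrow> \<theta> + t \<in> \<Theta>"
    using params_nbhd[OF assms] by blast
  define r where "r = r0 / 2"
  have r: "0 < r" "\<And>t. \<bar>t\<bar> \<le> 2 * r \<Longrightarrow> \<theta> + t \<in> \<Theta>"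
    using r0 by (auto simp: r_def)
  define t where "t n = r / real (Suc n)" for n
  have t_lim: "t \<longlonglongrightarrow> 0"
    unfolding t_def using LIMSEQ_Suc[OF lim_const_over_n[of r]] by simp
  have t_pos: "0 < t n" and t_le: "t n \<le> r" for n
    using r by (auto simp: t_def divide_le_eq)
  define w where "w x = (x - m)\<^sup>2 * exp (r * \<bar>x - m\<bar>)" for x
  have w_int: "integrable (P \<theta>) w"
    unfolding w_def using integrable_square_exp r by blast
  define q where "q n x = (exp (t n * (x - m)) - 1 - t n * (x - m)) / (t n)\<^sup>2" for n x
  have q_bound: "\<bar>q n x\<bar> \<le> w x" for n x
  proof -
    have "\<bar>q n x\<bar> \<le> (t n * (x - m))\<^sup>2 * exp \<bar>t n * (x - m)\<bar> / (t n)\<^sup>2"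
      unfolding q_def using exp_remainder_bounds[of "t n * (x - m)"] by (simp add: divide_right_mono)
    also have "\<dots> = (x - m)\<^sup>2 * exp (t n * \<bar>x - m\<bar>)"
      using t_pos[of n] by (simp add: power_mult_distrib abs_mult)
    also have "\<dots> \<le> w x"
      unfolding w_def using t_le[of n] by (intro mult_left_mono) (auto intro!: mult_right_mono)
    finally show ?thesis .
  qed
  have q_lim: "(\<lambda>n. q n x) \<longlonglongrightarrow> (x - m)\<^sup>2 / 2" for x
  proof -
    have "((\<lambda>t. (exp ((0 + t) * (x - m)) - exp (0 * (x - m)) - (x - m) * exp (0 * (x - m)) * t - (x - m)\<^sup>2 * t\<^sup>2 / 2) / t\<^sup>2) \<longlongrightarrow> 0) (nhds 0)"
      by (rule second_order_remainder[of UNIV, where f = "\<lambda>s. exp (s * (x - m))"])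
        (auto intro!: derivative_eq_intros simp: power2_eq_square)
    from tendsto_add[OF filterlim_compose[OF this t_lim] tendsto_const[of "(x - m)\<^sup>2 / 2"]]
    have "(\<lambda>n. (exp (t n * (x - m)) - 1 - (x - m) * t n - (x - m)\<^sup>2 * (t n)\<^sup>2 / 2) / (t n)\<^sup>2 + (x - m)\<^sup>2 / 2)
        \<longlonglongrightarrow> (x - m)\<^sup>2 / 2"
      by simp
    moreover have "(exp (t n * (x - m)) - 1 - (x - m) * t n - (x - m)\<^sup>2 * (t n)\<^sup>2 / 2) / (t n)\<^sup>2 + (x - m)\<^sup>2 / 2 = q n x" for n
      using t_pos[of n] by (simp add: q_def field_simps)
    ultimately show ?thesis by simp
  qed
  have q_meas: "q n \<in> borel_measurable (P \<theta>)" for n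
    unfolding q_def[abs_def] by measurable
  have dct: "integrable (P \<theta>) (\<lambda>x. (x - m)\<^sup>2 / 2)"
    by (rule integrable_dominated_convergence[where w = w and s = q])
      (use q_lim q_bound in \<open>auto intro: q_meas w_int\<close>)
  have q_int_lim: "(\<lambda>n. \<integral>x. q n x \<partial>P \<theta>) \<longlonglongrightarrow> (\<integral>x. (x - m)\<^sup>2 / 2 \<partial>P \<theta>)"
    by (rule integral_dominated_convergence[where w = w])
      (use q_lim q_bound in \<open>auto intro: q_meas w_int\<close>)
  define h where "h s = exp (b s - b \<theta> - (s - \<theta>) * m)" for s
  have q_integral: "(\<integral>x. q n x \<partial>P \<theta>) = (h (\<theta> + t n) - 1) / (t n)\<^sup>2" for n
  proof -
    have tn: "\<theta> + t n \<in> \<Theta>" using r(2)[of "t n"] t_pos[of n] t_le[of n] by simp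
    have "exp (t n * (x - m)) = exp (- t n * m) * exp (t n * x)" for x
      by (simp add: exp_add[symmetric] algebra_simps)
    then have "(\<integral>x. q n x \<partial>P \<theta>) = (\<integral>x. (exp (- t n * m) * exp (t n * x) - 1 - t n * (x - m)) / (t n)\<^sup>2 \<partial>P \<theta>)"
      by (simp add: q_def)
    also have "\<dots> = (exp (- t n * m) * exp (b (\<theta> + t n) - b \<theta>) - 1 - t n * (m - m)) / (t n)\<^sup>2"
      using exp_integral_exp_dist[OF tn] integrable_id[OF assms]
      by (simp add: prob_space[simplified] dist_mean_def[symmetric] m_def)
    also have "\<dots> = (h (\<theta> + t n) - 1) / (t n)\<^sup>2"
      by (simp add: h_def exp_add[symmetric] algebra_simps)
    finally show ?thesis .
  qed
  have m: "deriv b \<theta> = m" using mean_exp_dist[OF assms] by (simp add: m_def)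
  have "((\<lambda>t. (h (\<theta> + t) - h \<theta> - (deriv b \<theta> - m) * h \<theta> * t - v * t\<^sup>2 / 2) / t\<^sup>2) \<longlongrightarrow> 0) (nhds 0)"
  proof (rule second_order_remainder[OF open_params assms, where f' = "\<lambda>s. (deriv b s - m) * h s"])
    show deriv_h: "(h has_real_derivative (deriv b s - m) * h s) (at s)" if "s \<in> \<Theta>" for s
      unfolding h_def using b_deriv[OF that] by (auto intro!: derivative_eq_intros)
    show "((\<lambda>s. (deriv b s - m) * h s) has_real_derivative v) (at \<theta>)"
      by (rule DERIV_cong[OF DERIV_mult[OF DERIV_diff[OF b_deriv2[OF assms] DERIV_const] deriv_h[OF assms]]])
        (simp add: m v_def h_def)
  qed
  from tendsto_add[OF filterlim_compose[OF this t_lim] tendsto_const[of "v / 2"]]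
  have "(\<lambda>n. (h (\<theta> + t n) - 1 - v * (t n)\<^sup>2 / 2) / (t n)\<^sup>2 + v / 2) \<longlonglongrightarrow> v / 2"
    by (simp add: m h_def)
  moreover have "(h (\<theta> + t n) - 1 - v * (t n)\<^sup>2 / 2) / (t n)\<^sup>2 + v / 2 = (h (\<theta> + t n) - 1) / (t n)\<^sup>2" for n
    using t_pos[of n] by (simp add: field_simps)
  ultimately have "(\<lambda>n. \<integral>x. q n x \<partial>P \<theta>) \<longlonglongrightarrow> v / 2"
    by (simp add: q_integral)
  from LIMSEQ_unique[OF this q_int_lim] show "(\<integral>x. (x - dist_mean (P \<theta>))\<^sup>2 \<partial>P \<theta>) = deriv (deriv b) \<theta>"
    by (simp add: m_def v_def)
  show "integrable (P \<theta>) (\<lambda>x. (x - dist_mean (P \<theta>))\<^sup>2)"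
    using integrable_mult_left[OF dct, of 2] by (simp add: m_def)
qed

text \<open>
  With zero variance \<open>P \<theta>\<close> would be a point mass, and \<open>b\<close> would be affine near \<open>\<theta>\<close>, against strict
  convexity.
\<close>

lemma deriv2_pos:
  assumes "\<theta> \<in> \<Theta>"
  shows "0 < deriv (deriv b) \<theta>"
proof (rule ccontr)
  interpret prob_space "P \<theta>" using assms by (rule prob_exp_dist)
  assume "\<not> ?thesis"
  moreover have "0 \<le> deriv (deriv b) \<theta>"
    unfolding variance_exp_dist(1)[OF assms, symmetric] by simp
  ultimately have "(\<integral>x. (x - dist_mean (P \<theta>))\<^sup>2 \<partial>P \<theta>) = 0"
    using variance_exp_dist(1)[OF assms] by simp
  then have "AE x in P \<theta>. (x - dist_mean (P \<theta>))\<^sup>2 = 0"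
    using variance_exp_dist(2)[OF assms] by (subst (asm) integral_nonneg_eq_0_iff_AE) auto
  then have AE: "AE x in P \<theta>. x = dist_mean (P \<theta>)" by simp
  have affine: "b (\<theta> + t) = b \<theta> + t * dist_mean (P \<theta>)" if "\<theta> + t \<in> \<Theta>" for t
  proof -
    have "exp (b (\<theta> + t) - b \<theta>) = (\<integral>x. exp (t * x) \<partial>P \<theta>)"
      using exp_integral_exp_dist(2)[OF that] by simp
    also have "\<dots> = (\<integral>x. exp (t * dist_mean (P \<theta>)) \<partial>P \<theta>)"
      using AE by (intro integral_cong_AE) auto
    also have "\<dots> = exp (t * dist_mean (P \<theta>))"
      using prob_space by simp
    finally show ?thesis by simp
  qed
  obtain r where r: "0 < r" "\<And>t. \<bar>t\<bar> \<le> r \<Longrightarrow> \<theta> + t \<in> \<Theta>"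
    using params_nbhd[OF assms] by blast
  have "b ((1 - 1/2) * (\<theta> + - r) + 1/2 * (\<theta> + r)) < (1 - 1/2) * b (\<theta> + - r) + 1/2 * b (\<theta> + r)"
    using r(1) r(2)[of r] r(2)[of "- r"] by (intro b_strictly_convex) auto
  moreover have "(1 - 1/2) * (\<theta> + - r) + 1/2 * (\<theta> + r) = \<theta>"
    by (simp add: field_simps)
  ultimately have "b \<theta> < (b \<theta> - r * dist_mean (P \<theta>)) / 2 + (b \<theta> + r * dist_mean (P \<theta>)) / 2"
    using affine[of r] affine[of "- r"] r(1) r(2)[of r] r(2)[of "- r"] by simp
  then show False by (simp add: field_simps)
qed

lemma dist_sd_exp_dist: "\<theta> \<in> \<Theta> \<Longrightarrow> dist_sd (P \<theta>) = sqrt (deriv (deriv b) \<theta>)"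
  by (simp add: dist_sd_def variance_exp_dist)

sublocale convex_potential \<Theta> b "deriv b"
proof
  show "strict_mono_on \<Theta> (deriv b)"
  proof (rule strict_mono_onI)
    fix s t assume "s \<in> \<Theta>" "t \<in> \<Theta>" "s < t"
    then have "u \<in> \<Theta>" if "s \<le> u" "u \<le> t" for u
      using that interval_params by (meson is_interval_1)
    then show "deriv b s < deriv b t"
      by (intro DERIV_pos_imp_increasing[OF \<open>s < t\<close>] exI conjI) (auto intro: b_deriv2 deriv2_pos)
  qed
  show "continuous_on \<Theta> (deriv b)"
    using b_deriv2 DERIV_isCont continuous_at_imp_continuous_on by blast
qed (use open_params interval_params b_deriv in auto)

end

section \<open>The divergence and the ends of the interval\<close>

context exp_family
begin

lemma means_eq: "means \<xi> b = deriv b ` \<Theta>"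
  by (simp add: means_def exp_models_def image_image mean_exp_dist cong: image_cong)

lemma param_of_mean_deriv:
  assumes "\<theta> \<in> \<Theta>"
  shows "param_of_mean \<xi> b (deriv b \<theta>) = \<theta>"
proof -
  have "inj_on (\<lambda>\<theta>. dist_mean (P \<theta>)) \<Theta>"
    using strict_mono_on_imp_inj_on[OF deriv_strict_mono]
    by (simp add: mean_exp_dist cong: inj_on_cong)
  then show ?thesis
    unfolding param_of_mean_def by (rule the_inv_into_f_eq) (simp_all add: mean_exp_dist assms)
qed

lemma model_of_mean_deriv: "\<theta> \<in> \<Theta> \<Longrightarrow> model_of_mean \<xi> b (deriv b \<theta>) = P \<theta>"
  by (simp add: model_of_mean_def param_of_mean_deriv)

lemma isCont_param_of_mean:
  assumes "\<theta> \<in> \<Theta>"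
  shows "isCont (param_of_mean \<xi> b) (deriv b \<theta>)"
proof -
  obtain r where r: "0 < r" "\<And>t. \<bar>t\<bar> \<le> r \<Longrightarrow> \<theta> + t \<in> \<Theta>"
    using params_nbhd[OF assms] by blast
  have "z \<in> \<Theta>" if "\<bar>z - \<theta>\<bar> \<le> r" for z
    using r(2)[OF that] by simp
  then show ?thesis
    using isCont_inverse_function[OF r(1), of \<theta> "param_of_mean \<xi> b" "deriv b"]
      param_of_mean_deriv isCont_deriv by blast
qed


lemma KL_exp_dist:
  assumes s: "s \<in> \<Theta>" and t: "t \<in> \<Theta>"
  shows "KL_divergence (exp 1) (P t) (P s) = bregman b (deriv b) s t"
proof -
  interpret t: prob_space "P t" using t by (rule prob_exp_dist)
  interpret s: prob_space "P s" using s by (rule prob_exp_dist)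
  let ?f = "\<lambda>x. exp ((s - t) * x - (b s - b t))"
  have "KL_divergence (exp 1) (P t) (P s) = (\<integral>x. ?f x * log (exp 1) (?f x) \<partial>P t)"
    by (subst exp_dist_change_param[of s t], rule t.KL_density) auto
  also have "\<dots> = (\<integral>x. ?f x * ((s - t) * x - (b s - b t)) \<partial>P t)"
    by (simp add: log_def)
  also have "\<dots> = (\<integral>x. (s - t) * x - (b s - b t) \<partial>P s)"
    by (subst exp_dist_change_param[of s t], subst integral_density) auto
  also have "\<dots> = (s - t) * deriv b s - (b s - b t)"
    using integrable_id[OF s] mean_exp_dist[OF s] s.prob_space[simplified] by (simp add: dist_mean_def)
  finally show ?thesis by (simp add: bregman_def algebra_simps)
qed

lemma kl_div_deriv:
  assumes "s \<in> \<Theta>" "t \<in> \<Theta>"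
  shows "kl_div \<xi> b (deriv b s) (deriv b t) = ereal (bregman b (deriv b) s t)"
  using assms by (simp add: kl_div_def means_eq model_of_mean_deriv KL_exp_dist)

text \<open>
  Removes the case distinction in the definition of the divergence. For an attained mean
  \<open>y = b' s\<close>, Jensen's inequality under \<open>P s\<close> bounds every term of the supremum by the Bregman
  divergence, and the slope \<open>s - t\<close> that tilts \<open>P t\<close> into \<open>P s\<close> attains it.
\<close>

lemma kl_div_eq_Legendre:
  assumes t: "t \<in> \<Theta>"
  shows "kl_div \<xi> b y (deriv b t) = (SUP u. ereal (u * y) - log_mgf (P t) u)"
proof (cases "y \<in> means \<xi> b")
  case True
  then obtain s where s: "s \<in> \<Theta>" and y: "y = deriv b s" by (auto simp: means_eq)
  have le: "ereal (u * y) - log_mgf (P t) u \<le> ereal (bregman b (deriv b) s t)" for u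
  proof -
    have "ereal ((u + t - s) * y) \<le> log_mgf (P s) (u + t - s)"
      using mean_le_log_mgf[OF prob_exp_dist[OF s] sets_exp_dist integrable_id[OF s]]
      by (simp add: mean_exp_dist[OF s] y)
    then show ?thesis
      unfolding log_mgf_change_param[OF s, of t u]
      by (cases "log_mgf (P s) (u + t - s)") (auto simp: y bregman_def algebra_simps)
  qed
  have eq: "ereal ((s - t) * y) - log_mgf (P t) (s - t) = ereal (bregman b (deriv b) s t)"
    using log_mgf_exp_dist[of t "s - t"] s by (simp add: y bregman_def algebra_simps)
  have "(SUP u. ereal (u * y) - log_mgf (P t) u) = ereal (bregman b (deriv b) s t)"
  proof (rule antisym[OF SUP_least[OF le]])
    show "ereal (bregman b (deriv b) s t) \<le> (SUP u. ereal (u * y) - log_mgf (P t) u)"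
      unfolding eq[symmetric] by (rule SUP_upper) simp
  qed
  then show ?thesis using s t by (simp add: y kl_div_deriv)
next
  case False
  then show ?thesis by (simp add: kl_div_def model_of_mean_deriv[OF t])
qed

lemma kl_div_nonneg:
  assumes t: "t \<in> \<Theta>"
  shows "0 \<le> kl_div \<xi> b y (deriv b t)"
  unfolding kl_div_eq_Legendre[OF t]
  by (rule SUP_upper2[where i = 0]) (simp_all add: log_mgf_0[OF prob_exp_dist[OF t]])

text \<open>
  The hypothesis says that \<open>y'\<close> lies between \<open>y\<close> and the mean \<open>b' t\<close>. Slopes pointing from \<open>y'\<close> towards
  \<open>y\<close> give larger terms at \<open>y\<close>; the others point towards the mean, and their terms are at most \<open>0\<close> by
  Jensen's inequality. In this form it holds on both sides of the mean and for all real \<open>y\<close>, attained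
  as means or not.
\<close>

lemma kl_div_mono_away:
  assumes t: "t \<in> \<Theta>" and between: "0 \<le> (y' - y) * (deriv b t - y')"
  shows "kl_div \<xi> b y' (deriv b t) \<le> kl_div \<xi> b y (deriv b t)"
proof (cases "y = y'")
  case False
  show ?thesis
    unfolding kl_div_eq_Legendre[OF t, of y']
  proof (rule SUP_least)
    fix u :: real
    show "ereal (u * y') - log_mgf (P t) u \<le> kl_div \<xi> b y (deriv b t)"
    proof (cases "u * (y' - y) \<le> 0")
      case True
      then have "ereal (u * y') - log_mgf (P t) u \<le> ereal (u * y) - log_mgf (P t) u"
        by (intro ereal_minus_mono) (auto simp: algebra_simps)
      also have "\<dots> \<le> kl_div \<xi> b y (deriv b t)"
        unfolding kl_div_eq_Legendre[OF t] by (rule SUP_upper) simp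
      finally show ?thesis .
    next
      case False
      have "0 \<le> u * (deriv b t - y')"
        using False between \<open>y \<noteq> y'\<close> by (auto simp: mult_le_0_iff zero_le_mult_iff)
      moreover have "ereal (u * deriv b t) \<le> log_mgf (P t) u"
        using mean_le_log_mgf[OF prob_exp_dist[OF t] sets_exp_dist integrable_id[OF t]]
        by (simp add: mean_exp_dist[OF t])
      ultimately have "ereal (u * y') \<le> log_mgf (P t) u"
        by (cases "log_mgf (P t) u") (auto simp: algebra_simps)
      then have "ereal (u * y') - log_mgf (P t) u \<le> 0"
        by (cases "log_mgf (P t) u") auto
      also have "\<dots> \<le> kl_div \<xi> b y (deriv b t)"
        using t by (rule kl_div_nonneg)
      finally show ?thesis .
    qed
  qed
qed simp


lemma kl_right_ge: "ereal m \<le> kl_right \<xi> b n \<beta> m"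
proof (cases "{q \<in> means \<xi> b. m < q \<and> ereal (real n) * kl_div \<xi> b m q \<le> ereal \<beta>} = {}")
  case False
  then obtain q where q: "q \<in> {q \<in> means \<xi> b. m < q \<and> ereal (real n) * kl_div \<xi> b m q \<le> ereal \<beta>}"
    by blast
  then have "ereal m \<le> ereal q" by simp
  also have "\<dots> \<le> kl_right \<xi> b n \<beta> m"
    unfolding kl_right_def Let_def using q by (auto intro!: Sup_upper)
  finally show ?thesis .
qed (simp add: kl_right_def)

lemma kl_left_le: "kl_left \<xi> b n \<beta> m \<le> ereal m"
proof (cases "{q \<in> means \<xi> b. q < m \<and> ereal (real n) * kl_div \<xi> b m q \<le> ereal \<beta>} = {}")
  case False
  then obtain q where q: "q \<in> {q \<in> means \<xi> b. q < m \<and> ereal (real n) * kl_div \<xi> b m q \<le> ereal \<beta>}"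
    by blast
  then have "kl_left \<xi> b n \<beta> m \<le> ereal q"
    unfolding kl_left_def Let_def by (auto intro!: Inf_lower)
  also have "\<dots> \<le> ereal m" using q by simp
  finally show ?thesis .
qed (simp add: kl_left_def)

lemma kl_right_upper:
  assumes "q \<in> means \<xi> b" "m < q" "ereal (real n) * kl_div \<xi> b m q \<le> ereal \<beta>"
  shows "ereal q \<le> kl_right \<xi> b n \<beta> m"
  unfolding kl_right_def Let_def using assms by (auto intro!: Sup_upper)

lemma kl_left_lower:
  assumes "q \<in> means \<xi> b" "q < m" "ereal (real n) * kl_div \<xi> b m q \<le> ereal \<beta>"
  shows "kl_left \<xi> b n \<beta> m \<le> ereal q"
  unfolding kl_left_def Let_def using assms by (auto intro!: Inf_lower)

text \<open>
  A candidate \<open>q\<close> for \<open>m\<close> remains one for \<open>m'\<close> if \<open>m' < q\<close>, since the divergence has decreased;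
  otherwise it is at most \<open>m'\<close>, hence at most the right end of \<open>m'\<close>.
\<close>

lemma mono_kl_right: "mono (kl_right \<xi> b n \<beta>)"
proof (rule monoI)
  fix m m' :: real assume "m \<le> m'"
  have "ereal q \<le> kl_right \<xi> b n \<beta> m'"
    if q: "q \<in> means \<xi> b" "m < q" "ereal (real n) * kl_div \<xi> b m q \<le> ereal \<beta>" for q
  proof (cases "m' < q")
    case True
    obtain t where t: "t \<in> \<Theta>" "q = deriv b t" using q by (auto simp: means_eq)
    have "kl_div \<xi> b m' q \<le> kl_div \<xi> b m q"
      unfolding t using True \<open>m \<le> m'\<close> t by (intro kl_div_mono_away) auto
    then have "ereal (real n) * kl_div \<xi> b m' q \<le> ereal (real n) * kl_div \<xi> b m q"
      by (intro ereal_mult_left_mono) auto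
    with q True show ?thesis by (intro kl_right_upper) (auto intro: order_trans)
  next
    case False
    then show ?thesis using kl_right_ge[of m' n \<beta>] by (simp add: order_trans[of _ "ereal m'"])
  qed
  moreover have "ereal m \<le> kl_right \<xi> b n \<beta> m'"
    using \<open>m \<le> m'\<close> kl_right_ge[of m' n \<beta>] by (simp add: order_trans[of _ "ereal m'"])
  ultimately show "kl_right \<xi> b n \<beta> m \<le> kl_right \<xi> b n \<beta> m'"
    unfolding kl_right_def[of _ _ _ _ m] Let_def by (auto intro!: Sup_least)
qed

lemma mono_kl_left: "mono (kl_left \<xi> b n \<beta>)"
proof (rule monoI)
  fix m m' :: real assume "m \<le> m'"
  have "kl_left \<xi> b n \<beta> m \<le> ereal q"
    if q: "q \<in> means \<xi> b" "q < m'" "ereal (real n) * kl_div \<xi> b m' q \<le> ereal \<beta>" for q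
  proof (cases "q < m")
    case True
    obtain t where t: "t \<in> \<Theta>" "q = deriv b t" using q by (auto simp: means_eq)
    have "kl_div \<xi> b m q \<le> kl_div \<xi> b m' q"
      unfolding t using True \<open>m \<le> m'\<close> t by (intro kl_div_mono_away mult_nonpos_nonpos) auto
    then have "ereal (real n) * kl_div \<xi> b m q \<le> ereal (real n) * kl_div \<xi> b m' q"
      by (intro ereal_mult_left_mono) auto
    with q True show ?thesis by (intro kl_left_lower) (auto intro: order_trans)
  next
    case False
    then show ?thesis using kl_left_le[of n \<beta> m] by (simp add: order_trans[of _ "ereal m"])
  qed
  moreover have "kl_left \<xi> b n \<beta> m \<le> ereal m'"
    using \<open>m \<le> m'\<close> kl_left_le[of n \<beta> m] by (simp add: order_trans[of _ "ereal m"])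
  ultimately show "kl_left \<xi> b n \<beta> m \<le> kl_left \<xi> b n \<beta> m'"
    unfolding kl_left_def[of _ _ _ _ m'] Let_def by (auto intro!: Inf_greatest)
qed

text \<open>
  The two sets differ only by the centre \<open>a\<close>, whose value is the default of \<open>kl_right\<close> for an empty
  set of candidates and a lower bound of all candidates otherwise.
\<close>

lemma kl_right_eq_upper_end:
  assumes a: "a \<in> \<Theta>" and n: "0 < n" and \<beta>: "0 \<le> \<beta>"
  shows "kl_right \<xi> b n \<beta> (deriv b a) = upper_end \<Theta> b (deriv b) (ereal (\<beta> / real n)) a"
proof -
  have constraint: "ereal (real n) * kl_div \<xi> b (deriv b a) (deriv b t) \<le> ereal \<beta> \<longleftrightarrow>
      ereal (bregman b (deriv b) a t) \<le> ereal (\<beta> / real n)" if "t \<in> \<Theta>" for t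
    using a that n by (simp add: kl_div_deriv field_simps)
  show ?thesis
  proof (rule antisym)
    have base: "ereal (deriv b a) \<le> upper_end \<Theta> b (deriv b) (ereal (\<beta> / real n)) a"
      using a \<beta> by (intro upper_end_ge_deriv) auto
    have "ereal q \<le> upper_end \<Theta> b (deriv b) (ereal (\<beta> / real n)) a"
      if q: "q \<in> means \<xi> b" "deriv b a < q" "ereal (real n) * kl_div \<xi> b (deriv b a) q \<le> ereal \<beta>" for q
    proof -
      obtain t where t: "t \<in> \<Theta>" "q = deriv b t" using q by (auto simp: means_eq)
      with q show ?thesis
        using constraint[of t] deriv_less_iff[OF a, of t] by (auto intro!: upper_end_ge)
    qed
    with base show "kl_right \<xi> b n \<beta> (deriv b a) \<le> upper_end \<Theta> b (deriv b) (ereal (\<beta> / real n)) a"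
      unfolding kl_right_def Let_def by (auto intro!: Sup_least)
    have "ereal (deriv b t) \<le> kl_right \<xi> b n \<beta> (deriv b a)"
      if t: "t \<in> \<Theta>" "a \<le> t" "ereal (bregman b (deriv b) a t) \<le> ereal (\<beta> / real n)" for t
    proof (cases "a = t")
      case True then show ?thesis using kl_right_ge by simp
    next
      case False
      then show ?thesis
        using t constraint[of t] deriv_less_iff[OF a, of t] by (intro kl_right_upper) (auto simp: means_eq)
    qed
    then show "upper_end \<Theta> b (deriv b) (ereal (\<beta> / real n)) a \<le> kl_right \<xi> b n \<beta> (deriv b a)"
      unfolding upper_end_def by (auto intro!: Sup_least)
  qed
qed

lemma kl_left_eq_lower_end:
  assumes a: "a \<in> \<Theta>" and n: "0 < n" and \<beta>: "0 \<le> \<beta>"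
  shows "kl_left \<xi> b n \<beta> (deriv b a) = lower_end \<Theta> b (deriv b) (ereal (\<beta> / real n)) a"
proof -
  have constraint: "ereal (real n) * kl_div \<xi> b (deriv b a) (deriv b t) \<le> ereal \<beta> \<longleftrightarrow>
      ereal (bregman b (deriv b) a t) \<le> ereal (\<beta> / real n)" if "t \<in> \<Theta>" for t
    using a that n by (simp add: kl_div_deriv field_simps)
  show ?thesis
  proof (rule antisym)
    have base: "lower_end \<Theta> b (deriv b) (ereal (\<beta> / real n)) a \<le> ereal (deriv b a)"
      using a \<beta> by (intro lower_end_le_deriv) auto
    have "lower_end \<Theta> b (deriv b) (ereal (\<beta> / real n)) a \<le> ereal q"
      if q: "q \<in> means \<xi> b" "q < deriv b a" "ereal (real n) * kl_div \<xi> b (deriv b a) q \<le> ereal \<beta>" for q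
    proof -
      obtain t where t: "t \<in> \<Theta>" "q = deriv b t" using q by (auto simp: means_eq)
      with q show ?thesis
        using constraint[of t] deriv_less_iff[of t a] a unfolding lower_end_def by (auto intro!: Inf_lower)
    qed
    with base show "lower_end \<Theta> b (deriv b) (ereal (\<beta> / real n)) a \<le> kl_left \<xi> b n \<beta> (deriv b a)"
      unfolding kl_left_def Let_def by (auto intro!: Inf_greatest)
    have "kl_left \<xi> b n \<beta> (deriv b a) \<le> ereal (deriv b t)"
      if t: "t \<in> \<Theta>" "t \<le> a" "ereal (bregman b (deriv b) a t) \<le> ereal (\<beta> / real n)" for t
    proof (cases "a = t")
      case True then show ?thesis using kl_left_le by simp
    next
      case False
      then show ?thesis
        using t constraint[of t] deriv_less_iff[of t a] a by (intro kl_left_lower) (auto simp: means_eq)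
    qed
    then show "kl_left \<xi> b n \<beta> (deriv b a) \<le> lower_end \<Theta> b (deriv b) (ereal (\<beta> / real n)) a"
      unfolding lower_end_def by (auto intro!: Inf_greatest)
  qed
qed


text \<open>
  Near a mean every value is a mean, by the intermediate value theorem. Thus empirical means close
  to the true one have a parameter, which on the boundary of the support they need not have.
\<close>

lemma eventually_mean_attained:
  assumes a: "a \<in> \<Theta>" and y: "(y \<longlongrightarrow> deriv b a) F"
  shows "eventually (\<lambda>x. param_of_mean \<xi> b (y x) \<in> \<Theta> \<and> deriv b (param_of_mean \<xi> b (y x)) = y x) F"
proof -
  obtain r where r: "0 < r" "\<And>t. \<bar>t\<bar> \<le> r \<Longrightarrow> a + t \<in> \<Theta>"
    using params_nbhd[OF a] by blast
  have ends: "a - r \<in> \<Theta>" "a + r \<in> \<Theta>"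
    using r(1) r(2)[of r] r(2)[of "- r"] by auto
  have "deriv b (a - r) < deriv b a" "deriv b a < deriv b (a + r)"
    using r(1) deriv_less_iff a ends by auto
  from order_tendstoD(1)[OF y this(1)] order_tendstoD(2)[OF y this(2)]
  show ?thesis
  proof eventually_elim
    case (elim x)
    have "\<exists>t. a - r \<le> t \<and> t \<le> a + r \<and> deriv b t = y x"
    proof (rule IVT)
      show "\<forall>t. a - r \<le> t \<and> t \<le> a + r \<longrightarrow> isCont (deriv b) t"
        using isCont_deriv between_in_domain[OF ends] by blast
    qed (use elim r(1) in auto)
    then obtain t where t: "a - r \<le> t" "t \<le> a + r" "deriv b t = y x" by blast
    then have "t \<in> \<Theta>" using between_in_domain[OF ends] by blast
    then show ?case using param_of_mean_deriv t(3) by metis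
  qed
qed

lemma tendsto_param_of_mean:
  assumes a: "a \<in> \<Theta>" and y: "(y \<longlongrightarrow> deriv b a) F"
  shows "((\<lambda>x. param_of_mean \<xi> b (y x)) \<longlongrightarrow> a) F"
  using isCont_tendsto_compose[OF isCont_param_of_mean[OF a] y] by (simp add: param_of_mean_deriv[OF a])

lemma param_of_mean_has_derivative:
  assumes a: "a \<in> \<Theta>"
  shows "(param_of_mean \<xi> b has_real_derivative inverse (deriv (deriv b) a)) (at (deriv b a))"
proof -
  have "eventually (\<lambda>y. deriv b (param_of_mean \<xi> b y) = y) (nhds (deriv b a))"
    using eventually_mean_attained[OF a filterlim_ident] by (auto elim: eventually_mono)
  then obtain d where d: "0 < d" "\<And>y. dist y (deriv b a) < d \<Longrightarrow> deriv b (param_of_mean \<xi> b y) = y"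
    unfolding eventually_nhds_metric by blast
  show ?thesis
  proof (rule DERIV_inverse_function[where a = "deriv b a - d" and b = "deriv b a + d"])
    show "(deriv b has_real_derivative deriv (deriv b) a) (at (param_of_mean \<xi> b (deriv b a)))"
      using b_deriv2[OF a] by (simp add: param_of_mean_deriv[OF a])
    show "deriv b (param_of_mean \<xi> b y) = y" if "deriv b a - d < y" "y < deriv b a + d" for y
      using that by (intro d(2)) (auto simp: dist_real_def)
  qed (use d deriv2_pos[OF a] isCont_param_of_mean[OF a] in auto)
qed

text \<open>
  The inverse of \<open>b'\<close> is differentiable because the variance is positive, so deviations of order \<open>o(e)\<close>
  in the mean are of order \<open>o(e)\<close> in the parameter.
\<close>

lemma param_of_mean_rate:
  assumes a: "a \<in> \<Theta>" and e: "(e \<longlongrightarrow> 0) F" and e_pos: "eventually (\<lambda>x. 0 < e x) F"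
    and y: "((\<lambda>x. (y x - deriv b a) / e x) \<longlongrightarrow> 0) F"
  shows "((\<lambda>x. (param_of_mean \<xi> b (y x) - a) / e x) \<longlongrightarrow> 0) F"
    and "(y \<longlongrightarrow> deriv b a) F"
proof -
  define w where "w x = y x - deriv b a" for x
  define D where "D = inverse (deriv (deriv b) a)"
  have w_e: "((\<lambda>x. w x / e x) \<longlongrightarrow> 0) F" using y by (simp add: w_def)
  have "((\<lambda>x. w x / e x * e x) \<longlongrightarrow> 0) F"
    using tendsto_mult[OF w_e e] by simp
  then have w: "(w \<longlongrightarrow> 0) F"
    by (rule Lim_transform_eventually) (use e_pos in eventually_elim, simp)
  from tendsto_add[OF w tendsto_const[of "deriv b a"]] show "(y \<longlongrightarrow> deriv b a) F"
    by (simp add: w_def)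
  let ?R = "\<lambda>t. (param_of_mean \<xi> b (deriv b a + t) - param_of_mean \<xi> b (deriv b a) - D * t) / t"
  have "(?R \<longlongrightarrow> 0) (nhds 0)"
    unfolding D_def by (rule first_order_remainder[OF param_of_mean_has_derivative[OF a]])
  from filterlim_compose[OF this w]
  have "((\<lambda>x. w x / e x * ?R (w x) + D * (w x / e x)) \<longlongrightarrow> 0 * 0 + D * 0) F"
    by (intro tendsto_intros w_e)
  then have "((\<lambda>x. w x / e x * ?R (w x) + D * (w x / e x)) \<longlongrightarrow> 0) F" by simp
  then show "((\<lambda>x. (param_of_mean \<xi> b (y x) - a) / e x) \<longlongrightarrow> 0) F"
  proof (rule Lim_transform_eventually)
    have "w x / e x * ?R (w x) + D * (w x / e x) = (param_of_mean \<xi> b (y x) - a) / e x" for x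
    proof (cases "w x = 0")
      case True
      then show ?thesis using param_of_mean_deriv[OF a] by (simp add: w_def)
    next
      case False
      then show ?thesis
        by (simp add: param_of_mean_deriv[OF a] add_divide_distrib[symmetric]) (simp add: w_def)
    qed
    then show "eventually (\<lambda>x. w x / e x * ?R (w x) + D * (w x / e x)
      = (param_of_mean \<xi> b (y x) - a) / e x) F" by simp
  qed
qed

lemma tendsto_kl_ends:
  assumes a: "a \<in> \<Theta>" and y: "(y \<longlongrightarrow> deriv b a) F"
    and n: "eventually (\<lambda>x. 0 < n x) F" and \<beta>: "eventually (\<lambda>x. 0 \<le> \<beta> x) F"
    and g: "((\<lambda>x. ereal (\<beta> x / real (n x))) \<longlongrightarrow> g) F" and g_nonneg: "0 \<le> g"
  shows "((\<lambda>x. kl_right \<xi> b (n x) (\<beta> x) (y x)) \<longlongrightarrow> upper_end \<Theta> b (deriv b) g a) F"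
    and "((\<lambda>x. kl_left \<xi> b (n x) (\<beta> x) (y x)) \<longlongrightarrow> lower_end \<Theta> b (deriv b) g a) F"
proof -
  note attained = eventually_mean_attained[OF a y]
  have nonneg: "eventually (\<lambda>x. 0 \<le> ereal (\<beta> x / real (n x))) F"
    using \<beta> by eventually_elim simp
  show "((\<lambda>x. kl_right \<xi> b (n x) (\<beta> x) (y x)) \<longlongrightarrow> upper_end \<Theta> b (deriv b) g a) F"
    using tendsto_upper_end[OF a tendsto_param_of_mean[OF a y] g nonneg g_nonneg]
  proof (rule Lim_transform_eventually)
    show "eventually (\<lambda>x. upper_end \<Theta> b (deriv b) (ereal (\<beta> x / real (n x))) (param_of_mean \<xi> b (y x))
      = kl_right \<xi> b (n x) (\<beta> x) (y x)) F"
      using attained n \<beta> by eventually_elim (metis kl_right_eq_upper_end)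
  qed
  show "((\<lambda>x. kl_left \<xi> b (n x) (\<beta> x) (y x)) \<longlongrightarrow> lower_end \<Theta> b (deriv b) g a) F"
    using tendsto_lower_end[OF a tendsto_param_of_mean[OF a y] g nonneg g_nonneg]
  proof (rule Lim_transform_eventually)
    show "eventually (\<lambda>x. lower_end \<Theta> b (deriv b) (ereal (\<beta> x / real (n x))) (param_of_mean \<xi> b (y x))
      = kl_left \<xi> b (n x) (\<beta> x) (y x)) F"
      using attained n \<beta> by eventually_elim (metis kl_left_eq_lower_end)
  qed
qed

lemma kl_ends_asymptotics:
  assumes a: "a \<in> \<Theta>" and e: "(e \<longlongrightarrow> 0) F" and e_pos: "eventually (\<lambda>x. 0 < e x) F"
    and y: "((\<lambda>x. (y x - deriv b a) / e x) \<longlongrightarrow> 0) F"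
    and n: "eventually (\<lambda>x. 0 < n x) F" and \<beta>: "eventually (\<lambda>x. 0 \<le> \<beta> x) F"
    and g: "((\<lambda>x. \<beta> x / real (n x) / (e x)\<^sup>2) \<longlongrightarrow> 1) F"
  shows "((\<lambda>x. (kl_right \<xi> b (n x) (\<beta> x) (y x) - ereal (deriv b a)) / ereal (e x))
      \<longlongrightarrow> ereal (sqrt (2 * deriv (deriv b) a))) F"
    and "((\<lambda>x. (ereal (deriv b a) - kl_left \<xi> b (n x) (\<beta> x) (y x)) / ereal (e x))
      \<longlongrightarrow> ereal (sqrt (2 * deriv (deriv b) a))) F"
proof -
  note rate = param_of_mean_rate[OF a e e_pos y]
  note attained = eventually_mean_attained[OF a rate(2)]
  show "((\<lambda>x. (kl_right \<xi> b (n x) (\<beta> x) (y x) - ereal (deriv b a)) / ereal (e x))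
      \<longlongrightarrow> ereal (sqrt (2 * deriv (deriv b) a))) F"
    using upper_end_asymptotics[OF a b_deriv2[OF a] deriv2_pos[OF a] e e_pos rate(1) g]
  proof (rule Lim_transform_eventually)
    show "eventually (\<lambda>x. (upper_end \<Theta> b (deriv b) (ereal (\<beta> x / real (n x))) (param_of_mean \<xi> b (y x))
        - ereal (deriv b a)) / ereal (e x)
      = (kl_right \<xi> b (n x) (\<beta> x) (y x) - ereal (deriv b a)) / ereal (e x)) F"
      using attained n \<beta> by eventually_elim (metis kl_right_eq_upper_end)
  qed
  show "((\<lambda>x. (ereal (deriv b a) - kl_left \<xi> b (n x) (\<beta> x) (y x)) / ereal (e x))
      \<longlongrightarrow> ereal (sqrt (2 * deriv (deriv b) a))) F"
    using lower_end_asymptotics[OF a b_deriv2[OF a] deriv2_pos[OF a] e e_pos rate(1) g]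
  proof (rule Lim_transform_eventually)
    show "eventually (\<lambda>x. (ereal (deriv b a) - lower_end \<Theta> b (deriv b) (ereal (\<beta> x / real (n x))) (param_of_mean \<xi> b (y x)))
        / ereal (e x)
      = (ereal (deriv b a) - kl_left \<xi> b (n x) (\<beta> x) (y x)) / ereal (e x)) F"
      using attained n \<beta> by eventually_elim (metis kl_left_eq_lower_end)
  qed
qed

end

section \<open>The empirical mean of an i.i.d. sequence\<close>

context
  fixes \<nu> :: "real measure"
  assumes prob: "prob_space \<nu>" and sets_borel: "sets \<nu> = sets borel"
begin

lemma measurable_from_model: "f \<in> measurable borel N \<Longrightarrow> f \<in> measurable \<nu> N"
  by (simp add: measurable_cong_sets[OF sets_borel refl])

interpretation product_prob_space "\<lambda>_. \<nu>" "UNIV :: nat set"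
  by (rule product_prob_spaceI) (rule prob)

lemma prob_space_iid_seq: "prob_space (iid_seq \<nu>)"
  unfolding iid_seq_def by (rule prob_space_PiM) (rule prob)

lemma measurable_coordinate: "(\<lambda>\<omega>. \<omega> i) \<in> borel_measurable (iid_seq \<nu>)"
proof -
  have "(\<lambda>\<omega>. \<omega> i) \<in> measurable (iid_seq \<nu>) \<nu>"
    unfolding iid_seq_def by (rule measurable_component_singleton) simp
  then show ?thesis by (simp add: measurable_cong_sets[OF refl sets_borel])
qed

lemma measurable_emp_mean_iid [measurable]: "emp_mean n \<in> borel_measurable (iid_seq \<nu>)"
  unfolding emp_mean_def[abs_def]
  by (intro borel_measurable_divide borel_measurable_sum measurable_coordinate borel_measurable_const)

text \<open>
  Independence of the first \<open>n\<close> coordinates: the product depends on these only, and their joint law is a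
  finite product measure.
\<close>

lemma nn_integral_iid_prod:
  assumes "f \<in> borel_measurable borel"
  shows "(\<integral>\<^sup>+\<omega>. (\<Prod>i<n. f (\<omega> i)) \<partial>iid_seq \<nu>) = (\<integral>\<^sup>+x. f x \<partial>\<nu>) ^ n"
proof -
  have coordinate: "(\<lambda>x. f (x i)) \<in> borel_measurable (Pi\<^sub>M {..<n} (\<lambda>_. \<nu>))" if "i < n" for i
  proof (rule measurable_compose[where f = "\<lambda>x. x i" and g = f and N = \<nu>])
    show "(\<lambda>x. x i) \<in> measurable (Pi\<^sub>M {..<n} (\<lambda>_. \<nu>)) \<nu>"
      by (rule measurable_component_singleton) (use that in simp)
  qed (rule measurable_from_model[OF assms])
  have "(\<integral>\<^sup>+\<omega>. (\<Prod>i<n. f (\<omega> i)) \<partial>iid_seq \<nu>)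
      = (\<integral>\<^sup>+\<omega>. (\<Prod>i<n. f (restrict \<omega> {..<n} i)) \<partial>iid_seq \<nu>)"
    by simp
  also have "\<dots> = (\<integral>\<^sup>+y. (\<Prod>i<n. f (y i)) \<partial>distr (iid_seq \<nu>) (Pi\<^sub>M {..<n} (\<lambda>_. \<nu>)) (\<lambda>\<omega>. restrict \<omega> {..<n}))"
    unfolding iid_seq_def
    by (rule nn_integral_distr[symmetric, OF measurable_restrict_subset])
      (auto intro!: borel_measurable_prod_ennreal coordinate)
  also have "\<dots> = (\<integral>\<^sup>+y. (\<Prod>i<n. f (y i)) \<partial>Pi\<^sub>M {..<n} (\<lambda>_. \<nu>))"
    unfolding iid_seq_def by (subst distr_PiM_restrict_finite) auto
  also have "\<dots> = (\<Prod>i<n. \<integral>\<^sup>+x. f x \<partial>\<nu>)"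
    by (rule product_nn_integral_prod) (auto intro: measurable_from_model assms)
  finally show ?thesis by simp
qed

text \<open>
  Markov's inequality for \<open>exp (n u X)\<close>, where \<open>X\<close> is the empirical mean. When the moment generating
  function diverges at \<open>u\<close>, the event is empty.
\<close>

lemma Chernoff_emp_mean:
  assumes n: "0 < n"
  shows "measure (iid_seq \<nu>) {\<omega> \<in> space (iid_seq \<nu>). ereal g \<le> ereal (u * emp_mean n \<omega>) - log_mgf \<nu> u}
    \<le> exp (- real n * g)"
proof -
  interpret iid: prob_space "iid_seq \<nu>" by (rule prob_space_iid_seq)
  let ?m = "\<integral>\<^sup>+x. ennreal (exp (u * x)) \<partial>\<nu>"
  show ?thesis
  proof (cases ?m)
    case top
    then have "log_mgf \<nu> u = \<infinity>" by (simp add: log_mgf_def)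
    then show ?thesis by simp
  next
    case (real r)
    have "?m \<noteq> 0"
    proof
      assume "?m = 0"
      then have "AE x in \<nu>. ennreal (exp (u * x)) = 0"
        by (subst (asm) nn_integral_0_iff_AE) (auto intro: measurable_from_model)
      then show False by (simp add: prob_space.AE_False[OF prob])
    qed
    with real have "0 < r" by (cases "r = 0") auto
    have log_r: "log_mgf \<nu> u = ereal (ln r)"
      using real by (simp add: log_mgf_def)
    define c where "c = exp (- real n * g) / r ^ n"
    have "0 \<le> c" using \<open>0 < r\<close> by (simp add: c_def)
    let ?Y = "\<lambda>\<omega>. ennreal (exp (real n * (u * emp_mean n \<omega>)))"
    have Y: "?Y \<omega> = (\<Prod>i<n. ennreal (exp (u * \<omega> i)))" for \<omega>
    proof -
      have "(\<Sum>i<n. u * \<omega> i) = real n * (u * emp_mean n \<omega>)"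
        using n by (simp add: emp_mean_def sum_distrib_left[symmetric])
      then show ?thesis
        by (simp add: prod_ennreal exp_sum[symmetric])
    qed
    have subset: "{\<omega> \<in> space (iid_seq \<nu>). ereal g \<le> ereal (u * emp_mean n \<omega>) - log_mgf \<nu> u}
        \<subseteq> {\<omega> \<in> space (iid_seq \<nu>). 1 \<le> ennreal c * ?Y \<omega>}"
    proof safe
      fix \<omega> assume "ereal g \<le> ereal (u * emp_mean n \<omega>) - log_mgf \<nu> u"
      then have "g \<le> u * emp_mean n \<omega> - ln r" by (simp add: log_r)
      then have "real n * g \<le> real n * (u * emp_mean n \<omega> - ln r)"
        by (intro mult_left_mono) auto
      then have "1 \<le> exp (- real n * g - real n * ln r + real n * (u * emp_mean n \<omega>))"
        by (simp add: algebra_simps)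
      also have "\<dots> = c * exp (real n * (u * emp_mean n \<omega>))"
      proof -
        have "exp (real n * ln r) = r ^ n" using \<open>0 < r\<close> by (simp add: exp_of_nat_mult)
        then show ?thesis by (simp only: c_def exp_add exp_diff)
      qed
      finally show "1 \<le> ennreal c * ?Y \<omega>"
        using \<open>0 \<le> c\<close> by (simp add: ennreal_mult[symmetric])
    qed
    have "emeasure (iid_seq \<nu>) {\<omega> \<in> space (iid_seq \<nu>). 1 \<le> ennreal c * ?Y \<omega>}
        \<le> ennreal c * (\<integral>\<^sup>+\<omega>. ?Y \<omega> * indicator (space (iid_seq \<nu>)) \<omega> \<partial>iid_seq \<nu>)"
      by (rule nn_integral_Markov_inequality) measurable
    also have "(\<integral>\<^sup>+\<omega>. ?Y \<omega> * indicator (space (iid_seq \<nu>)) \<omega> \<partial>iid_seq \<nu>) = (\<integral>\<^sup>+\<omega>. ?Y \<omega> \<partial>iid_seq \<nu>)"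
      by (rule nn_integral_cong) simp
    also have "\<dots> = ennreal r ^ n"
      unfolding Y using nn_integral_iid_prod[of "\<lambda>x. ennreal (exp (u * x))" n] real by simp
    also have "ennreal c * ennreal r ^ n = ennreal (exp (- real n * g))"
      using \<open>0 < r\<close> \<open>0 \<le> c\<close> by (simp add: ennreal_power ennreal_mult[symmetric] c_def)
    finally have "iid.prob {\<omega> \<in> space (iid_seq \<nu>). 1 \<le> ennreal c * ?Y \<omega>} \<le> exp (- real n * g)"
      by (simp add: iid.emeasure_eq_measure)
    moreover have "iid.prob {\<omega> \<in> space (iid_seq \<nu>). ereal g \<le> ereal (u * emp_mean n \<omega>) - log_mgf \<nu> u}
        \<le> iid.prob {\<omega> \<in> space (iid_seq \<nu>). 1 \<le> ennreal c * ?Y \<omega>}"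
      by (rule iid.finite_measure_mono[OF subset]) measurable
    ultimately show ?thesis by simp
  qed
qed

end

context exp_family
begin

text \<open>
  Chernoff's bound with a slope for which the quadratic bound \<open>\<Lambda>(u) \<le> \<mu> u + v u\<^sup>2\<close> holds; the Taylor
  coefficient is \<open>v / 2\<close>, so there is room near \<open>0\<close>. The slopes \<open>\<plusminus> t / (2 v)\<close> optimise the
  resulting exponent to \<open>t\<^sup>2 / (4 v)\<close>.
\<close>

lemma emp_mean_concentration:
  assumes a: "a \<in> \<Theta>"
  obtains r where "0 < r" "\<And>n t. 0 < n \<Longrightarrow> 0 < t \<Longrightarrow> t \<le> r \<Longrightarrow>
    measure (iid_seq (P a)) {\<omega> \<in> space (iid_seq (P a)). t \<le> \<bar>emp_mean n \<omega> - deriv b a\<bar>}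
      \<le> 2 * exp (- real n * (t\<^sup>2 / (4 * deriv (deriv b) a)))"
proof -
  interpret iid: prob_space "iid_seq (P a)"
    by (rule prob_space_iid_seq[OF prob_exp_dist[OF a] sets_exp_dist])
  have meas [measurable]: "emp_mean n \<in> borel_measurable (iid_seq (P a))" for n
    using measurable_emp_mean_iid[OF prob_exp_dist[OF a] sets_exp_dist] .
  define \<mu> where "\<mu> = deriv b a"
  define v where "v = deriv (deriv b) a"
  have v: "0 < v" unfolding v_def using a by (rule deriv2_pos)
  obtain r0 where r0: "0 < r0" "\<And>t. \<bar>t\<bar> \<le> r0 \<Longrightarrow> a + t \<in> \<Theta>"
    using params_nbhd[OF a] by blast
  have "((\<lambda>u. (b (a + u) - b a - \<mu> * u - v * u\<^sup>2 / 2) / u\<^sup>2) \<longlongrightarrow> 0) (nhds 0)"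
    unfolding \<mu>_def v_def by (rule second_order_remainder[OF open_params a b_deriv b_deriv2[OF a]])
  then have "eventually (\<lambda>u. \<bar>(b (a + u) - b a - \<mu> * u - v * u\<^sup>2 / 2) / u\<^sup>2\<bar> < v / 2) (nhds 0)"
    using tendstoD[of _ 0 _ "v / 2"] v by (force simp: dist_real_def)
  then obtain r1 where r1: "0 < r1"
    "\<And>u. \<bar>u\<bar> < r1 \<Longrightarrow> \<bar>(b (a + u) - b a - \<mu> * u - v * u\<^sup>2 / 2) / u\<^sup>2\<bar> < v / 2"
    unfolding eventually_nhds_metric by (auto simp: dist_real_def)
  have mgf: "log_mgf (P a) u \<le> ereal (\<mu> * u + v * u\<^sup>2)" if u: "\<bar>u\<bar> \<le> r0" "\<bar>u\<bar> < r1" "u \<noteq> 0" for u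
  proof -
    have "(b (a + u) - b a - \<mu> * u - v * u\<^sup>2 / 2) / u\<^sup>2 < v / 2"
      using r1(2)[OF u(2)] by (simp only: abs_less_iff)
    then have "b (a + u) - b a \<le> \<mu> * u + v * u\<^sup>2"
      using u(3) by (simp add: pos_divide_less_eq field_simps)
    then show ?thesis
      using log_mgf_exp_dist[OF r0(2)[OF u(1)]] by simp
  qed
  define r where "r = min (2 * v * r0) (v * r1)"
  show ?thesis
  proof (rule that)
    show "0 < r" using v r0(1) r1(1) by (simp add: r_def)
    fix n :: nat and t :: real
    assume n: "0 < n" and t: "0 < t" "t \<le> r"
    define g where "g = t\<^sup>2 / (4 * v)"
    define u where "u = t / (2 * v)"
    have u: "0 < u" "u \<le> r0" "u < r1"
      using t v r1(1) by (auto simp: u_def r_def field_simps)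
    let ?E = "\<lambda>s. {\<omega> \<in> space (iid_seq (P a)). ereal g \<le> ereal (s * emp_mean n \<omega>) - log_mgf (P a) s}"
    have E_le: "iid.prob (?E s) \<le> exp (- real n * g)" for s
      by (rule Chernoff_emp_mean[OF prob_exp_dist[OF a] sets_exp_dist n])
    have E_meas: "?E s \<in> iid.events" for s by measurable
    have opt: "u * t - v * u\<^sup>2 = g"
      using v by (simp add: u_def g_def power2_eq_square field_simps)
    have in_E: "\<omega> \<in> ?E s"
      if "\<omega> \<in> space (iid_seq (P a))" "\<bar>s\<bar> = u" "u * t \<le> s * (emp_mean n \<omega> - \<mu>)" for \<omega> s
    proof -
      have "log_mgf (P a) s \<le> ereal (\<mu> * s + v * u\<^sup>2)"
        using mgf[of s] that(2) u by (metis abs_zero less_irrefl power2_abs)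
      moreover have "g + (\<mu> * s + v * u\<^sup>2) \<le> s * emp_mean n \<omega>"
        using that(3) opt by (simp add: algebra_simps)
      ultimately have "ereal g \<le> ereal (s * emp_mean n \<omega>) - log_mgf (P a) s"
        by (cases "log_mgf (P a) s") auto
      with that(1) show ?thesis by simp
    qed
    have "{\<omega> \<in> space (iid_seq (P a)). t \<le> \<bar>emp_mean n \<omega> - \<mu>\<bar>} \<subseteq> ?E u \<union> ?E (- u)"
    proof
      fix \<omega> assume \<omega>: "\<omega> \<in> {\<omega> \<in> space (iid_seq (P a)). t \<le> \<bar>emp_mean n \<omega> - \<mu>\<bar>}"
      show "\<omega> \<in> ?E u \<union> ?E (- u)"
      proof (cases "0 \<le> emp_mean n \<omega> - \<mu>")
        case True
        then have "u * t \<le> u * (emp_mean n \<omega> - \<mu>)"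
          using \<omega> u(1) by (intro mult_left_mono) auto
        then show ?thesis using in_E[of \<omega> u] \<omega> u(1) by simp
      next
        case False
        then have "u * t \<le> u * (- (emp_mean n \<omega> - \<mu>))"
          using \<omega> u(1) by (intro mult_left_mono) auto
        then have "u * t \<le> - u * (emp_mean n \<omega> - \<mu>)" by (simp add: algebra_simps)
        then show ?thesis using in_E[of \<omega> "- u"] \<omega> u(1) by simp
      qed
    qed
    then have "iid.prob {\<omega> \<in> space (iid_seq (P a)). t \<le> \<bar>emp_mean n \<omega> - \<mu>\<bar>} \<le> iid.prob (?E u \<union> ?E (- u))"
      using E_meas by (intro iid.finite_measure_mono) auto
    also have "\<dots> \<le> iid.prob (?E u) + iid.prob (?E (- u))"
      using E_meas by (intro measure_Un_le)
    also have "\<dots> \<le> 2 * exp (- real n * g)"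
      using E_le[of u] E_le[of "- u"] by linarith
    finally show "iid.prob {\<omega> \<in> space (iid_seq (P a)). t \<le> \<bar>emp_mean n \<omega> - deriv b a\<bar>}
      \<le> 2 * exp (- real n * (t\<^sup>2 / (4 * deriv (deriv b) a)))"
      by (simp add: g_def v_def \<mu>_def)
  qed
qed

text \<open>
  With \<open>e = 1\<close> this is the weak law of large numbers. With \<open>e = sqrt (log (1 / \<delta>) / n)\<close> it says that the
  fluctuations are negligible on the scale of the confidence interval.
\<close>

lemma scaled_emp_mean_tendsto:
  assumes a: "a \<in> \<Theta>" and n: "eventually (\<lambda>x. 0 < n x) F"
    and e_pos: "eventually (\<lambda>x. 0 < e x) F" and e_bound: "eventually (\<lambda>x. e x \<le> 1) F"
    and slow: "filterlim (\<lambda>x. real (n x) * (e x)\<^sup>2) at_top F"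
  shows "tendsto_in_prob (iid_seq (P a)) (\<lambda>x \<omega>. (emp_mean (n x) \<omega> - deriv b a) / e x) 0 F"
  unfolding tendsto_in_prob_def
proof (intro allI impI)
  fix U :: "real set" assume "open U" "0 \<in> U"
  interpret iid: prob_space "iid_seq (P a)"
    by (rule prob_space_iid_seq[OF prob_exp_dist[OF a] sets_exp_dist])
  have meas [measurable]: "emp_mean n \<in> borel_measurable (iid_seq (P a))" for n
    using measurable_emp_mean_iid[OF prob_exp_dist[OF a] sets_exp_dist] .
  obtain r where r: "0 < r" "\<And>n t. 0 < n \<Longrightarrow> 0 < t \<Longrightarrow> t \<le> r \<Longrightarrow>
    iid.prob {\<omega> \<in> space (iid_seq (P a)). t \<le> \<bar>emp_mean n \<omega> - deriv b a\<bar>}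
      \<le> 2 * exp (- real n * (t\<^sup>2 / (4 * deriv (deriv b) a)))"
    using emp_mean_concentration[OF a] by blast
  obtain h0 where h0: "0 < h0" "ball 0 h0 \<subseteq> U"
    using \<open>open U\<close> \<open>0 \<in> U\<close> open_contains_ball by blast
  define h where "h = min h0 r"
  have h: "0 < h" "h \<le> r" "\<And>z. \<bar>z\<bar> < h \<Longrightarrow> z \<in> U"
    using h0 r(1) by (auto simp: h_def subset_iff)
  define k where "k = h\<^sup>2 / (4 * deriv (deriv b) a)"
  have k: "0 < k" using h(1) deriv2_pos[OF a] by (simp add: k_def)
  have "filterlim (\<lambda>x. k * (real (n x) * (e x)\<^sup>2)) at_top F"
    by (rule filterlim_tendsto_pos_mult_at_top[OF tendsto_const k slow])
  then have "((\<lambda>x. 2 * exp (- (k * (real (n x) * (e x)\<^sup>2)))) \<longlongrightarrow> 2 * 0) F"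
    by (intro tendsto_mult tendsto_const filterlim_compose[OF exp_at_bot])
      (simp add: filterlim_uminus_at_bot)
  then have lim: "((\<lambda>x. 2 * exp (- (k * (real (n x) * (e x)\<^sup>2)))) \<longlongrightarrow> 0) F" by simp
  show "((\<lambda>x. iid.prob {\<omega> \<in> space (iid_seq (P a)). (emp_mean (n x) \<omega> - deriv b a) / e x \<notin> U}) \<longlongrightarrow> 0) F"
  proof (rule tendsto_sandwich[OF _ _ tendsto_const lim])
    show "eventually (\<lambda>x. iid.prob {\<omega> \<in> space (iid_seq (P a)). (emp_mean (n x) \<omega> - deriv b a) / e x \<notin> U}
        \<le> 2 * exp (- (k * (real (n x) * (e x)\<^sup>2)))) F"
      using n e_pos e_bound
    proof eventually_elim
      case (elim x)
      have "h * e x \<le> h" using elim h(1) by (simp add: mult_left_le)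
      then have small: "0 < h * e x" "h * e x \<le> r" using h(1,2) elim by (simp, linarith)
      have "{\<omega> \<in> space (iid_seq (P a)). (emp_mean (n x) \<omega> - deriv b a) / e x \<notin> U}
          \<subseteq> {\<omega> \<in> space (iid_seq (P a)). h * e x \<le> \<bar>emp_mean (n x) \<omega> - deriv b a\<bar>}"
      proof safe
        fix \<omega> assume "(emp_mean (n x) \<omega> - deriv b a) / e x \<notin> U"
        then have "h \<le> \<bar>(emp_mean (n x) \<omega> - deriv b a) / e x\<bar>" using h(3) by (meson not_le)
        then show "h * e x \<le> \<bar>emp_mean (n x) \<omega> - deriv b a\<bar>"
          using elim by (simp add: abs_divide pos_le_divide_eq)
      qed
      then have "iid.prob {\<omega> \<in> space (iid_seq (P a)). (emp_mean (n x) \<omega> - deriv b a) / e x \<notin> U}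
          \<le> iid.prob {\<omega> \<in> space (iid_seq (P a)). h * e x \<le> \<bar>emp_mean (n x) \<omega> - deriv b a\<bar>}"
        by (rule iid.finite_measure_mono) measurable
      also have "\<dots> \<le> 2 * exp (- real (n x) * ((h * e x)\<^sup>2 / (4 * deriv (deriv b) a)))"
        using elim small by (intro r(2)) auto
      also have "\<dots> = 2 * exp (- (k * (real (n x) * (e x)\<^sup>2)))"
        by (simp add: k_def power_mult_distrib mult_ac)
      finally show ?case .
    qed
  qed simp
qed

end

section \<open>Coverage\<close>

text \<open>
  Sublevel sets of a monotone function are intervals.
\<close>

lemma borel_measurable_mono_ereal:
  fixes f :: "real \<Rightarrow> ereal"
  assumes "mono f"
  shows "f \<in> borel_measurable borel"
proof (rule borel_measurableI_le)
  fix y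
  have "is_interval {x. f x \<le> y}"
    unfolding is_interval_1 using monoD[OF assms] by (auto intro: order_trans)
  then show "{x \<in> space borel. f x \<le> y} \<in> sets borel"
    using real_interval_borel_measurable by simp
qed

text \<open>
  A down-closed set without maximum is an increasing union of half-lines that end at points of the set:
  its rational points are cofinal, and the running maxima of an enumeration of them increase.
\<close>

lemma (in prob_space) prob_down_closed_le:
  fixes X :: "'a \<Rightarrow> real"
  assumes X [measurable]: "X \<in> borel_measurable M"
    and down: "\<And>y z. y \<in> J \<Longrightarrow> z \<le> y \<Longrightarrow> z \<in> J"
    and bound: "\<And>y. y \<in> J \<Longrightarrow> prob {\<omega> \<in> space M. X \<omega> \<le> y} \<le> c" and c: "0 \<le> c"
  shows "prob {\<omega> \<in> space M. X \<omega> \<in> J} \<le> c"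
proof (cases "\<exists>y\<in>J. \<forall>z\<in>J. z \<le> y")
  case True
  then obtain y where y: "y \<in> J" "\<And>z. z \<in> J \<Longrightarrow> z \<le> y" by blast
  then have "{\<omega> \<in> space M. X \<omega> \<in> J} = {\<omega> \<in> space M. X \<omega> \<le> y}"
    using down by blast
  with bound y show ?thesis by simp
next
  case no_max: False
  define Q where "Q = \<rat> \<inter> J"
  have dense: "\<exists>q\<in>Q. y < q" if "y \<in> J" for y
  proof -
    obtain z where z: "z \<in> J" "y < z" using no_max \<open>y \<in> J\<close> by (meson not_le)
    obtain q where q: "q \<in> \<rat>" "y < q" "q < z" using Rats_dense_in_real[OF z(2)] by blast
    then have "q \<in> Q" using down[OF z(1), of q] by (simp add: Q_def)
    with q show ?thesis by blast
  qed
  show ?thesis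
  proof (cases "J = {}")
    case False
    then have Q: "countable Q" "Q \<noteq> {}"
      using dense countable_subset[OF Int_lower1 countable_rat] unfolding Q_def by blast+
    define y where "y k = Max (from_nat_into Q ` {..k})" for k
    have y_in: "y k \<in> J" for k
    proof -
      have "y k \<in> from_nat_into Q ` {..k}" unfolding y_def by (rule Max_in) auto
      then show ?thesis using from_nat_into[OF Q(2)] by (auto simp: Q_def)
    qed
    let ?A = "\<lambda>k. {\<omega> \<in> space M. X \<omega> \<le> y k}"
    have "y k \<le> y l" if "k \<le> l" for k l
      unfolding y_def using that by (intro Max_mono) auto
    then have "incseq ?A" by (auto simp: incseq_def intro: order_trans)
    then have "(\<lambda>k. prob (?A k)) \<longlonglongrightarrow> prob (\<Union>k. ?A k)"
      by (intro finite_Lim_measure_incseq) auto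
    then have "prob (\<Union>k. ?A k) \<le> c"
      using bound[OF y_in] by (intro LIMSEQ_le_const2) auto
    moreover have "(\<Union>k. ?A k) = {\<omega> \<in> space M. X \<omega> \<in> J}"
    proof safe
      fix \<omega> k assume "X \<omega> \<le> y k" then show "X \<omega> \<in> J" using down y_in by blast
    next
      fix \<omega> assume "\<omega> \<in> space M" "X \<omega> \<in> J"
      then obtain q where q: "q \<in> Q" "X \<omega> < q" using dense by blast
      then obtain k where "q = from_nat_into Q k"
        using from_nat_into_surj[OF Q(1) q(1)] by blast
      then have "q \<le> y k" unfolding y_def by (intro Max_ge) auto
      with q \<open>\<omega> \<in> space M\<close> show "\<omega> \<in> (\<Union>k. ?A k)" by (auto intro!: exI[of _ k])
    qed
    ultimately show ?thesis by simp
  qed (simp add: c)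
qed

context exp_family
begin

text \<open>
  The sign condition says that the empirical mean is at least as far from the true mean as \<open>y\<close>, on the
  same side. As \<open>n d(y, \<mu>) > \<beta> \<ge> 0\<close>, some slope \<open>u\<close> certifies the divergence. By Jensen's inequality
  \<open>u\<close> points away from the true mean, so it certifies the same bound at all points beyond \<open>y\<close>.
\<close>

lemma emp_mean_beyond:
  assumes a: "a \<in> \<Theta>" and n: "0 < n" and \<beta>: "0 \<le> \<beta>"
    and far: "ereal \<beta> < ereal (real n) * kl_div \<xi> b y (deriv b a)"
  shows "measure (iid_seq (P a))
      {\<omega> \<in> space (iid_seq (P a)). 0 \<le> (emp_mean n \<omega> - y) * (y - deriv b a)} \<le> exp (- \<beta>)"
proof -
  interpret iid: prob_space "iid_seq (P a)"
    by (rule prob_space_iid_seq[OF prob_exp_dist[OF a] sets_exp_dist])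
  define g where "g = \<beta> / real n"
  have "ereal g < kl_div \<xi> b y (deriv b a)"
    using far n by (cases "kl_div \<xi> b y (deriv b a)") (auto simp: g_def field_simps)
  then obtain u where u: "ereal g < ereal (u * y) - log_mgf (P a) u"
    unfolding kl_div_eq_Legendre[OF a] less_SUP_iff by blast
  have jensen: "ereal (u * deriv b a) \<le> log_mgf (P a) u"
    using mean_le_log_mgf[OF prob_exp_dist[OF a] sets_exp_dist integrable_id[OF a]]
    by (simp add: mean_exp_dist[OF a])
  have "0 \<le> g" using \<beta> by (simp add: g_def)
  have dir: "0 < u * (y - deriv b a)"
    using u jensen \<open>0 \<le> g\<close> by (cases "log_mgf (P a) u") (auto simp: algebra_simps)
  have "{\<omega> \<in> space (iid_seq (P a)). 0 \<le> (emp_mean n \<omega> - y) * (y - deriv b a)}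
      \<subseteq> {\<omega> \<in> space (iid_seq (P a)). ereal g \<le> ereal (u * emp_mean n \<omega>) - log_mgf (P a) u}"
  proof safe
    fix \<omega> assume "0 \<le> (emp_mean n \<omega> - y) * (y - deriv b a)"
    with dir have "0 \<le> u * (emp_mean n \<omega> - y)"
      by (auto simp: zero_less_mult_iff zero_le_mult_iff)
    with u show "ereal g \<le> ereal (u * emp_mean n \<omega>) - log_mgf (P a) u"
      by (cases "log_mgf (P a) u") (auto simp: algebra_simps)
  qed
  moreover have "{\<omega> \<in> space (iid_seq (P a)). ereal g \<le> ereal (u * emp_mean n \<omega>) - log_mgf (P a) u} \<in> iid.events"
    using measurable_emp_mean_iid[OF prob_exp_dist[OF a] sets_exp_dist] by measurable
  ultimately have "iid.prob {\<omega> \<in> space (iid_seq (P a)). 0 \<le> (emp_mean n \<omega> - y) * (y - deriv b a)}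
      \<le> exp (- real n * g)"
    using Chernoff_emp_mean[OF prob_exp_dist[OF a] sets_exp_dist n, of g u]
    by (meson iid.finite_measure_mono order_trans)
  then show ?thesis using n by (simp add: g_def)
qed

text \<open>
  If the right end for \<open>y\<close> is below the true mean \<open>\<mu>\<close>, then \<open>y < \<mu>\<close> and \<open>\<mu>\<close> is no candidate, hence
  \<open>n d(y, \<mu>) > \<beta>\<close>. By monotonicity of the end such \<open>y\<close> form a down-closed set; for the left end this
  is so after changing signs.
\<close>

lemma kl_ends_miss:
  assumes a: "a \<in> \<Theta>" and n: "0 < n" and \<beta>: "0 \<le> \<beta>"
  shows "measure (iid_seq (P a)) {\<omega> \<in> space (iid_seq (P a)).
      kl_right \<xi> b n \<beta> (emp_mean n \<omega>) < ereal (deriv b a)} \<le> exp (- \<beta>)"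
    and "measure (iid_seq (P a)) {\<omega> \<in> space (iid_seq (P a)).
      ereal (deriv b a) < kl_left \<xi> b n \<beta> (emp_mean n \<omega>)} \<le> exp (- \<beta>)"
proof -
  interpret iid: prob_space "iid_seq (P a)"
    by (rule prob_space_iid_seq[OF prob_exp_dist[OF a] sets_exp_dist])
  have meas [measurable]: "emp_mean n \<in> borel_measurable (iid_seq (P a))"
    using measurable_emp_mean_iid[OF prob_exp_dist[OF a] sets_exp_dist] .
  let ?\<mu> = "deriv b a"
  have mean: "?\<mu> \<in> means \<xi> b" using a by (simp add: means_eq)
  have "iid.prob {\<omega> \<in> space (iid_seq (P a)). emp_mean n \<omega> \<in> {y. kl_right \<xi> b n \<beta> y < ereal ?\<mu>}} \<le> exp (- \<beta>)"
  proof (rule iid.prob_down_closed_le[OF meas])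
    fix y z assume "y \<in> {y. kl_right \<xi> b n \<beta> y < ereal ?\<mu>}" "z \<le> y"
    then show "z \<in> {y. kl_right \<xi> b n \<beta> y < ereal ?\<mu>}"
      using monoD[OF mono_kl_right, of z y n \<beta>] by (auto intro: le_less_trans)
  next
    fix y assume y: "y \<in> {y. kl_right \<xi> b n \<beta> y < ereal ?\<mu>}"
    then have "ereal y < ereal ?\<mu>" using le_less_trans[OF kl_right_ge] by blast
    then have "y < ?\<mu>" by simp
    then have "ereal \<beta> < ereal (real n) * kl_div \<xi> b y ?\<mu>"
      using kl_right_upper[OF mean, of y n \<beta>] y by (auto simp flip: not_le)
    from emp_mean_beyond[OF a n \<beta> this]
    have "iid.prob {\<omega> \<in> space (iid_seq (P a)). 0 \<le> (emp_mean n \<omega> - y) * (y - ?\<mu>)} \<le> exp (- \<beta>)" .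
    moreover have "iid.prob {\<omega> \<in> space (iid_seq (P a)). emp_mean n \<omega> \<le> y}
        \<le> iid.prob {\<omega> \<in> space (iid_seq (P a)). 0 \<le> (emp_mean n \<omega> - y) * (y - ?\<mu>)}"
      using \<open>y < ?\<mu>\<close> by (intro iid.finite_measure_mono) (auto intro: mult_nonpos_nonpos)
    ultimately show "iid.prob {\<omega> \<in> space (iid_seq (P a)). emp_mean n \<omega> \<le> y} \<le> exp (- \<beta>)" by simp
  qed simp
  then show "iid.prob {\<omega> \<in> space (iid_seq (P a)). kl_right \<xi> b n \<beta> (emp_mean n \<omega>) < ereal ?\<mu>} \<le> exp (- \<beta>)"
    by simp
  have "iid.prob {\<omega> \<in> space (iid_seq (P a)). - emp_mean n \<omega> \<in> {y. ereal ?\<mu> < kl_left \<xi> b n \<beta> (- y)}} \<le> exp (- \<beta>)"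
  proof (rule iid.prob_down_closed_le)
    fix y z assume "y \<in> {y. ereal ?\<mu> < kl_left \<xi> b n \<beta> (- y)}" "z \<le> y"
    then show "z \<in> {y. ereal ?\<mu> < kl_left \<xi> b n \<beta> (- y)}"
      using monoD[OF mono_kl_left, of "- y" "- z" n \<beta>] by (auto intro: less_le_trans)
  next
    fix z assume z: "z \<in> {y. ereal ?\<mu> < kl_left \<xi> b n \<beta> (- y)}"
    define y where "y = - z"
    have y: "ereal ?\<mu> < kl_left \<xi> b n \<beta> y" using z by (simp add: y_def)
    then have "ereal ?\<mu> < ereal y" using kl_left_le by (rule less_le_trans)
    then have "?\<mu> < y" by simp
    then have "ereal \<beta> < ereal (real n) * kl_div \<xi> b y ?\<mu>"
      using kl_left_lower[OF mean, of y n \<beta>] y by (auto simp flip: not_le)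
    from emp_mean_beyond[OF a n \<beta> this]
    have "iid.prob {\<omega> \<in> space (iid_seq (P a)). 0 \<le> (emp_mean n \<omega> - y) * (y - ?\<mu>)} \<le> exp (- \<beta>)" .
    moreover have "iid.prob {\<omega> \<in> space (iid_seq (P a)). - emp_mean n \<omega> \<le> z}
        \<le> iid.prob {\<omega> \<in> space (iid_seq (P a)). 0 \<le> (emp_mean n \<omega> - y) * (y - ?\<mu>)}"
      using \<open>?\<mu> < y\<close> by (intro iid.finite_measure_mono) (auto simp: y_def)
    ultimately show "iid.prob {\<omega> \<in> space (iid_seq (P a)). - emp_mean n \<omega> \<le> z} \<le> exp (- \<beta>)" by simp
  qed simp_all
  then show "iid.prob {\<omega> \<in> space (iid_seq (P a)). ereal ?\<mu> < kl_left \<xi> b n \<beta> (emp_mean n \<omega>)} \<le> exp (- \<beta>)"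
    by simp
qed


lemma ci_right_kl_policy: "ci_right (kl_policy \<xi> b) n \<delta> \<omega> = kl_right \<xi> b n (ln (2 / \<delta>)) (emp_mean n \<omega>)"
  by (simp add: ci_right_def kl_policy_def emp_mean_def)

lemma ci_left_kl_policy: "ci_left (kl_policy \<xi> b) n \<delta> \<omega> = kl_left \<xi> b n (ln (2 / \<delta>)) (emp_mean n \<omega>)"
  by (simp add: ci_left_def kl_policy_def emp_mean_def)

lemma is_policy_kl_policy: "is_policy (kl_policy \<xi> b)"
  unfolding is_policy_def
proof (intro allI impI conjI)
  fix n :: nat and \<delta> :: real
  have mean: "emp_mean n \<in> borel_measurable (Pi\<^sub>M {..<n} (\<lambda>_. borel))"
    unfolding emp_mean_def[abs_def]
    by (intro borel_measurable_divide borel_measurable_sum borel_measurable_const measurable_component_singleton)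
  show "(\<lambda>x. fst (kl_policy \<xi> b n \<delta> x)) \<in> borel_measurable (Pi\<^sub>M {..<n} (\<lambda>_. borel))"
    unfolding kl_policy_def fst_conv
    by (rule measurable_compose[OF mean borel_measurable_mono_ereal[OF mono_kl_left]])
  show "(\<lambda>x. snd (kl_policy \<xi> b n \<delta> x)) \<in> borel_measurable (Pi\<^sub>M {..<n} (\<lambda>_. borel))"
    unfolding kl_policy_def snd_conv
    by (rule measurable_compose[OF mean borel_measurable_mono_ereal[OF mono_kl_right]])
  show "ci_left (kl_policy \<xi> b) n \<delta> \<omega> \<le> ci_right (kl_policy \<xi> b) n \<delta> \<omega>" for \<omega>
    unfolding ci_left_kl_policy ci_right_kl_policy
    by (rule order_trans[OF kl_left_le kl_right_ge])
qed

lemma kl_policy_in_Pi_CI: "kl_policy \<xi> b \<in> Pi_CI \<xi> b"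
proof -
  have "1 - \<delta> \<le> measure (iid_seq (P a)) {\<omega> \<in> space (iid_seq (P a)).
      ci_left (kl_policy \<xi> b) n \<delta> \<omega> \<le> ereal (dist_mean (P a))
      \<and> ereal (dist_mean (P a)) \<le> ci_right (kl_policy \<xi> b) n \<delta> \<omega>}"
    if a: "a \<in> \<Theta>" and n: "0 < n" and \<delta>: "0 < \<delta>" "\<delta> < 1" for a n \<delta>
  proof -
    interpret iid: prob_space "iid_seq (P a)"
      by (rule prob_space_iid_seq[OF prob_exp_dist[OF a] sets_exp_dist])
    have mean: "emp_mean n \<in> borel_measurable (iid_seq (P a))"
      using measurable_emp_mean_iid[OF prob_exp_dist[OF a] sets_exp_dist] .
    define \<beta> where "\<beta> = ln (2 / \<delta>)"
    have \<beta>: "0 \<le> \<beta>" "exp (- \<beta>) = \<delta> / 2"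
      using \<delta> by (auto simp: \<beta>_def exp_minus)
    have [measurable]: "(\<lambda>\<omega>. kl_left \<xi> b n \<beta> (emp_mean n \<omega>)) \<in> borel_measurable (iid_seq (P a))"
      "(\<lambda>\<omega>. kl_right \<xi> b n \<beta> (emp_mean n \<omega>)) \<in> borel_measurable (iid_seq (P a))"
      by (rule measurable_compose[OF mean borel_measurable_mono_ereal[OF mono_kl_left]],
          rule measurable_compose[OF mean borel_measurable_mono_ereal[OF mono_kl_right]])
    let ?C = "{\<omega> \<in> space (iid_seq (P a)). kl_left \<xi> b n \<beta> (emp_mean n \<omega>) \<le> ereal (deriv b a)
      \<and> ereal (deriv b a) \<le> kl_right \<xi> b n \<beta> (emp_mean n \<omega>)}"
    let ?R = "{\<omega> \<in> space (iid_seq (P a)). kl_right \<xi> b n \<beta> (emp_mean n \<omega>) < ereal (deriv b a)}"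
    let ?L = "{\<omega> \<in> space (iid_seq (P a)). ereal (deriv b a) < kl_left \<xi> b n \<beta> (emp_mean n \<omega>)}"
    have C: "?C \<in> iid.events" and R: "?R \<in> iid.events" and L: "?L \<in> iid.events"
      by measurable
    have "1 - iid.prob ?C = iid.prob (space (iid_seq (P a)) - ?C)"
      using iid.prob_compl[OF C] by simp
    also have "\<dots> \<le> iid.prob (?R \<union> ?L)"
      using R L by (intro iid.finite_measure_mono) (auto simp: not_le)
    also have "\<dots> \<le> iid.prob ?R + iid.prob ?L"
      using R L by (rule measure_Un_le)
    also have "\<dots> \<le> \<delta>"
      using kl_ends_miss[OF a n \<beta>(1)] \<beta>(2) by linarith
    finally show ?thesis
      by (simp add: ci_left_kl_policy ci_right_kl_policy mean_exp_dist[OF a] \<beta>_def[symmetric])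
  qed
  then show ?thesis
    unfolding Pi_CI_def exp_models_def using is_policy_kl_policy by auto
qed

end

section \<open>Limits in probability of the ends\<close>

text \<open>
  Continuous mapping with a varying map: everything asymptotic about \<open>\<Phi>\<close> is deterministic and enters
  as one limit along a product filter. Its exceptional events are contained in those of \<open>Y\<close>.
\<close>

lemma (in prob_space) tendsto_in_prob_map:
  fixes Y :: "'i \<Rightarrow> 'a \<Rightarrow> 'b::topological_space"
  assumes Y: "tendsto_in_prob M Y c F"
    and meas: "eventually (\<lambda>i. Y i \<in> borel_measurable M) F"
    and \<Phi>: "((\<lambda>(i, y). \<Phi> i y) \<longlongrightarrow> L) (F \<times>\<^sub>F nhds c)"
  shows "tendsto_in_prob M (\<lambda>i \<omega>. \<Phi> i (Y i \<omega>)) L F"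
  unfolding tendsto_in_prob_def
proof (intro allI impI)
  fix U assume "open U" "L \<in> U"
  then have "eventually (\<lambda>(i, y). \<Phi> i y \<in> U) (F \<times>\<^sub>F nhds c)"
    using topological_tendstoD[OF \<Phi>] by (simp add: case_prod_beta')
  then obtain A B where A: "eventually A F" and B: "eventually B (nhds c)"
    and AB: "\<And>i y. A i \<Longrightarrow> B y \<Longrightarrow> \<Phi> i y \<in> U"
    unfolding eventually_prod_filter by auto
  obtain V where V: "open V" "c \<in> V" "\<And>y. y \<in> V \<Longrightarrow> B y"
    using B unfolding eventually_nhds by blast
  have lim: "((\<lambda>i. prob {\<omega> \<in> space M. Y i \<omega> \<notin> V}) \<longlongrightarrow> 0) F"
    using Y V unfolding tendsto_in_prob_def by blast
  show "((\<lambda>i. prob {\<omega> \<in> space M. \<Phi> i (Y i \<omega>) \<notin> U}) \<longlongrightarrow> 0) F"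
  proof (rule tendsto_sandwich[OF _ _ tendsto_const lim])
    show "eventually (\<lambda>i. 0 \<le> prob {\<omega> \<in> space M. \<Phi> i (Y i \<omega>) \<notin> U}) F" by simp
    show "eventually (\<lambda>i. prob {\<omega> \<in> space M. \<Phi> i (Y i \<omega>) \<notin> U} \<le> prob {\<omega> \<in> space M. Y i \<omega> \<notin> V}) F"
      using A meas
    proof eventually_elim
      case (elim i)
      have "{\<omega> \<in> space M. Y i \<omega> \<notin> V} = Y i -` (- V) \<inter> space M" by auto
      also have "\<dots> \<in> events"
        using elim V(1) by (intro measurable_sets[where A = borel]) auto
      finally show ?case
        using AB[OF elim(1)] V(3) by (intro finite_measure_mono) auto
    qed
  qed
qed

lemma eventually_at_right_unit_interval: "eventually (\<lambda>\<delta>::real. 0 < \<delta> \<and> \<delta> < 1) (at_right 0)"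
  unfolding eventually_at_right_field by (intro exI[of _ 1]) simp

lemma filterlim_ln_inverse: "filterlim (\<lambda>\<delta>::real. ln (1 / \<delta>)) at_top (at_right 0)"
  by real_asymp

lemma log_ratio_tendsto: "((\<lambda>\<delta>::real. ln (2 / \<delta>) / ln (1 / \<delta>)) \<longlongrightarrow> 1) (at_right 0)"
  by real_asymp

text \<open>
  The threshold is asymptotic to \<open>ln (1 / \<delta>)\<close>, so the radius \<open>ln (2 / \<delta>) / N\<close> converges to the
  reciprocal of the limit of the sample ratio, with \<open>1 / 0 = \<infinity>\<close>.
\<close>

lemma threshold_ratio_limit:
  assumes N_pos: "eventually (\<lambda>\<delta>. 0 < N \<delta>) (at_right 0)"
    and c: "0 \<le> c" and lim: "((\<lambda>\<delta>. ereal (sample_ratio N \<delta>)) \<longlongrightarrow> c) (at_right 0)"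
  shows "\<exists>g\<ge>0. ((\<lambda>\<delta>. ereal (ln (2 / \<delta>) / real (N \<delta>))) \<longlongrightarrow> g) (at_right 0)"
proof -
  let ?q = "\<lambda>\<delta>::real. ln (2 / \<delta>) / ln (1 / \<delta>)"
  have ratio_pos: "eventually (\<lambda>\<delta>. 0 < sample_ratio N \<delta>) (at_right 0)"
    using N_pos eventually_at_right_unit_interval by eventually_elim (simp add: sample_ratio_def)
  have eq: "eventually (\<lambda>\<delta>. ?q \<delta> / sample_ratio N \<delta> = ln (2 / \<delta>) / real (N \<delta>)) (at_right 0)"
    using eventually_at_right_unit_interval by eventually_elim (simp add: sample_ratio_def)
  consider "c = \<infinity>" | "c = 0" | k where "0 < k" "c = ereal k"
    using c by (cases c) (auto simp: zero_ereal_def order_le_less)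
  then show ?thesis
  proof cases
    case 1
    then have "filterlim (sample_ratio N) at_top (at_right 0)"
      using lim tendsto_PInfty_eq_at_top by metis
    from tendsto_divide_0[OF log_ratio_tendsto filterlim_at_top_imp_at_infinity[OF this]]
    have "((\<lambda>\<delta>. ln (2 / \<delta>) / real (N \<delta>)) \<longlongrightarrow> 0) (at_right 0)"
      using eq by (rule Lim_transform_eventually)
    then show ?thesis by (intro exI[of _ "ereal 0"]) (simp add: zero_ereal_def)
  next
    case 2
    then have "(sample_ratio N \<longlongrightarrow> 0) (at_right 0)"
      using lim by (simp add: zero_ereal_def)
    from filterlim_tendsto_pos_mult_at_top[OF log_ratio_tendsto zero_less_one
        filterlim_inverse_at_top[OF this ratio_pos]]
    have "filterlim (\<lambda>\<delta>. ?q \<delta> / sample_ratio N \<delta>) at_top (at_right 0)"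
      by (simp add: divide_inverse)
    then have "filterlim (\<lambda>\<delta>. ln (2 / \<delta>) / real (N \<delta>)) at_top (at_right 0)"
      using filterlim_cong[OF refl refl eq] by blast
    then have "((\<lambda>\<delta>. ereal (ln (2 / \<delta>) / real (N \<delta>))) \<longlongrightarrow> \<infinity>) (at_right 0)"
      by (simp add: tendsto_PInfty_eq_at_top)
    then show ?thesis by (intro exI[of _ \<infinity>]) simp
  next
    case 3
    then have "(sample_ratio N \<longlongrightarrow> k) (at_right 0)"
      using lim by simp
    from tendsto_divide[OF log_ratio_tendsto this] have "((\<lambda>\<delta>. ?q \<delta> / sample_ratio N \<delta>) \<longlongrightarrow> 1 / k) (at_right 0)"
      using \<open>0 < k\<close> by simp
    then have "((\<lambda>\<delta>. ln (2 / \<delta>) / real (N \<delta>)) \<longlongrightarrow> 1 / k) (at_right 0)"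
      using eq by (rule Lim_transform_eventually)
    then show ?thesis using \<open>0 < k\<close> by (intro exI[of _ "ereal (1 / k)"]) simp
  qed
qed

lemma ci_scale_limits:
  assumes N_pos: "eventually (\<lambda>\<delta>. 0 < N \<delta>) (at_right 0)"
    and ratio: "filterlim (sample_ratio N) at_top (at_right 0)"
  shows "eventually (\<lambda>\<delta>. 0 < ci_scale N \<delta>) (at_right 0)"
    and "(ci_scale N \<longlongrightarrow> 0) (at_right 0)"
    and "filterlim (\<lambda>\<delta>. real (N \<delta>) * (ci_scale N \<delta>)\<^sup>2) at_top (at_right 0)"
    and "((\<lambda>\<delta>. ln (2 / \<delta>) / real (N \<delta>) / (ci_scale N \<delta>)\<^sup>2) \<longlongrightarrow> 1) (at_right 0)"
proof -
  show "eventually (\<lambda>\<delta>. 0 < ci_scale N \<delta>) (at_right 0)"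
    using N_pos eventually_at_right_unit_interval by eventually_elim (simp add: ci_scale_def)
  have "((\<lambda>\<delta>. inverse (sample_ratio N \<delta>)) \<longlongrightarrow> 0) (at_right 0)"
    using ratio by (intro tendsto_inverse_0_at_top)
  from tendsto_real_sqrt[OF this] show "(ci_scale N \<longlongrightarrow> 0) (at_right 0)"
    by (simp add: sample_ratio_def ci_scale_def[abs_def])
  have square: "eventually (\<lambda>\<delta>. (ci_scale N \<delta>)\<^sup>2 = ln (1 / \<delta>) / real (N \<delta>)) (at_right 0)"
    using eventually_at_right_unit_interval by eventually_elim (simp add: ci_scale_def)
  have "eventually (\<lambda>\<delta>. ln (1 / \<delta>) = real (N \<delta>) * (ci_scale N \<delta>)\<^sup>2) (at_right 0)"
    using square N_pos by eventually_elim simp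
  from filterlim_cong[OF refl refl this] filterlim_ln_inverse
  show "filterlim (\<lambda>\<delta>. real (N \<delta>) * (ci_scale N \<delta>)\<^sup>2) at_top (at_right 0)" by blast
  have "eventually (\<lambda>\<delta>. ln (2 / \<delta>) / ln (1 / \<delta>) = ln (2 / \<delta>) / real (N \<delta>) / (ci_scale N \<delta>)\<^sup>2) (at_right 0)"
    using square N_pos by eventually_elim simp
  with log_ratio_tendsto
  show "((\<lambda>\<delta>. ln (2 / \<delta>) / real (N \<delta>) / (ci_scale N \<delta>)\<^sup>2) \<longlongrightarrow> 1) (at_right 0)"
    by (rule Lim_transform_eventually)
qed

context exp_family
begin

context
  fixes a :: real and N :: "real \<Rightarrow> nat"
  assumes a: "a \<in> \<Theta>"
    and N_pos: "eventually (\<lambda>\<delta>. 0 < N \<delta>) (at_right 0)"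
begin

interpretation iid: prob_space "iid_seq (P a)"
  by (rule prob_space_iid_seq[OF prob_exp_dist[OF a] sets_exp_dist])

lemma scaled_deviation_measurable:
  "(\<lambda>\<omega>. (emp_mean n \<omega> - deriv b a) / e) \<in> borel_measurable (iid_seq (P a))"
  using measurable_emp_mean_iid[OF prob_exp_dist[OF a] sets_exp_dist] by measurable

lemma eventually_log_nonneg: "eventually (\<lambda>\<delta>::real. 0 \<le> ln (2 / \<delta>)) (at_right 0)"
  using eventually_at_right_unit_interval by eventually_elim simp

lemma tendsto_in_prob_ends:
  assumes N: "filterlim N at_top (at_right 0)"
    and g: "((\<lambda>\<delta>. ereal (ln (2 / \<delta>) / real (N \<delta>))) \<longlongrightarrow> g) (at_right 0)" and g_nonneg: "0 \<le> g"
  shows "tendsto_in_prob (iid_seq (P a)) (\<lambda>\<delta>. ci_right (kl_policy \<xi> b) (N \<delta>) \<delta>)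
      (upper_end \<Theta> b (deriv b) g a) (at_right 0)"
    and "tendsto_in_prob (iid_seq (P a)) (\<lambda>\<delta>. ci_left (kl_policy \<xi> b) (N \<delta>) \<delta>)
      (lower_end \<Theta> b (deriv b) g a) (at_right 0)"
proof -
  let ?F = "at_right 0 \<times>\<^sub>F nhds (0::real)"
  have "filterlim (\<lambda>\<delta>. real (N \<delta>) * 1\<^sup>2) at_top (at_right 0)"
    using filterlim_compose[OF filterlim_real_sequentially N] by simp
  then have Z: "tendsto_in_prob (iid_seq (P a)) (\<lambda>\<delta> \<omega>. (emp_mean (N \<delta>) \<omega> - deriv b a) / 1) 0 (at_right 0)"
    by (intro scaled_emp_mean_tendsto[OF a N_pos]) auto
  have "((\<lambda>x. deriv b a + snd x) \<longlongrightarrow> deriv b a + 0) ?F"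
    by (intro tendsto_add tendsto_const filterlim_snd)
  then have y: "((\<lambda>x. deriv b a + snd x) \<longlongrightarrow> deriv b a) ?F" by simp
  note map_deviation = iid.tendsto_in_prob_map[OF Z always_eventually[OF allI[OF scaled_deviation_measurable]]]
  note lims = tendsto_kl_ends[OF a y eventually_compose_filterlim[OF N_pos filterlim_fst]
      eventually_compose_filterlim[OF eventually_log_nonneg filterlim_fst]
      filterlim_compose[OF g filterlim_fst] g_nonneg]
  have "((\<lambda>(\<delta>, z). kl_right \<xi> b (N \<delta>) (ln (2 / \<delta>)) (deriv b a + z)) \<longlongrightarrow> upper_end \<Theta> b (deriv b) g a) ?F"
    using lims(1) by (simp add: case_prod_beta')
  from map_deviation[OF this]
  show "tendsto_in_prob (iid_seq (P a)) (\<lambda>\<delta>. ci_right (kl_policy \<xi> b) (N \<delta>) \<delta>)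
      (upper_end \<Theta> b (deriv b) g a) (at_right 0)"
    by (simp add: ci_right_kl_policy[abs_def])
  have "((\<lambda>(\<delta>, z). kl_left \<xi> b (N \<delta>) (ln (2 / \<delta>)) (deriv b a + z)) \<longlongrightarrow> lower_end \<Theta> b (deriv b) g a) ?F"
    using lims(2) by (simp add: case_prod_beta')
  from map_deviation[OF this]
  show "tendsto_in_prob (iid_seq (P a)) (\<lambda>\<delta>. ci_left (kl_policy \<xi> b) (N \<delta>) \<delta>)
      (lower_end \<Theta> b (deriv b) g a) (at_right 0)"
    by (simp add: ci_left_kl_policy[abs_def])
qed

text \<open>
  The deterministic expansions are applied at \<open>\<mu> + e z\<close>, where \<open>z\<close> is the deviation of the empirical
  mean in units of the scale \<open>e\<close>, which tends to \<open>0\<close> in probability. The width is the sum of the two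
  halves, and its limit is taken before passing to probability.
\<close>

lemma tendsto_in_prob_scaled_ends:
  assumes ratio: "filterlim (sample_ratio N) at_top (at_right 0)"
  shows "tendsto_in_prob (iid_seq (P a))
      (\<lambda>\<delta> \<omega>. (ci_right (kl_policy \<xi> b) (N \<delta>) \<delta> \<omega> - ereal (deriv b a)) / ereal (ci_scale N \<delta>))
      (ereal (sqrt (2 * deriv (deriv b) a))) (at_right 0)"
    and "tendsto_in_prob (iid_seq (P a))
      (\<lambda>\<delta> \<omega>. (ereal (deriv b a) - ci_left (kl_policy \<xi> b) (N \<delta>) \<delta> \<omega>) / ereal (ci_scale N \<delta>))
      (ereal (sqrt (2 * deriv (deriv b) a))) (at_right 0)"
    and "tendsto_in_prob (iid_seq (P a))
      (\<lambda>\<delta> \<omega>. (ci_right (kl_policy \<xi> b) (N \<delta>) \<delta> \<omega> - ci_left (kl_policy \<xi> b) (N \<delta>) \<delta> \<omega>) / ereal (ci_scale N \<delta>))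
      (ereal (2 * sqrt (2 * deriv (deriv b) a))) (at_right 0)"
proof -
  let ?F = "at_right 0 \<times>\<^sub>F nhds (0::real)"
  let ?\<mu> = "deriv b a" and ?s = "sqrt (2 * deriv (deriv b) a)"
  let ?y = "\<lambda>x. ?\<mu> + ci_scale N (fst x) * snd x"
  note scale = ci_scale_limits[OF N_pos ratio]
  have scale_pos: "eventually (\<lambda>x. 0 < ci_scale N (fst x)) ?F"
    using eventually_compose_filterlim[OF scale(1) filterlim_fst] .
  have "eventually (\<lambda>\<delta>. ci_scale N \<delta> < 1) (at_right 0)"
    using order_tendstoD(2)[OF scale(2)] by simp
  then have scale_le: "eventually (\<lambda>\<delta>. ci_scale N \<delta> \<le> 1) (at_right 0)"
    by eventually_elim simp
  have Z: "tendsto_in_prob (iid_seq (P a)) (\<lambda>\<delta> \<omega>. (emp_mean (N \<delta>) \<omega> - ?\<mu>) / ci_scale N \<delta>) 0 (at_right 0)"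
    by (rule scaled_emp_mean_tendsto[OF a N_pos scale(1) scale_le scale(3)])
  have y: "((\<lambda>x. (?y x - ?\<mu>) / ci_scale N (fst x)) \<longlongrightarrow> 0) ?F"
    using filterlim_snd
    by (rule Lim_transform_eventually) (use scale_pos in eventually_elim, simp)
  note lims = kl_ends_asymptotics[OF a filterlim_compose[OF scale(2) filterlim_fst] scale_pos y
      eventually_compose_filterlim[OF N_pos filterlim_fst]
      eventually_compose_filterlim[OF eventually_log_nonneg filterlim_fst]
      filterlim_compose[OF scale(4) filterlim_fst]]
  let ?R = "\<lambda>\<delta> z. kl_right \<xi> b (N \<delta>) (ln (2 / \<delta>)) (?\<mu> + ci_scale N \<delta> * z)"
  let ?L = "\<lambda>\<delta> z. kl_left \<xi> b (N \<delta>) (ln (2 / \<delta>)) (?\<mu> + ci_scale N \<delta> * z)"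
  have in_prob_of_mean: "tendsto_in_prob (iid_seq (P a)) (\<lambda>\<delta> \<omega>. \<phi> \<delta> (emp_mean (N \<delta>) \<omega>)) l (at_right 0)"
    if "((\<lambda>(\<delta>, z). \<phi> \<delta> (?\<mu> + ci_scale N \<delta> * z)) \<longlongrightarrow> l) ?F"
    for \<phi> :: "real \<Rightarrow> real \<Rightarrow> ereal" and l
  proof -
    have *: "tendsto_in_prob (iid_seq (P a))
        (\<lambda>\<delta> \<omega>. \<phi> \<delta> (?\<mu> + ci_scale N \<delta> * ((emp_mean (N \<delta>) \<omega> - ?\<mu>) / ci_scale N \<delta>))) l (at_right 0)"
      using iid.tendsto_in_prob_map[OF Z always_eventually[OF allI[OF scaled_deviation_measurable]] that] .
    show ?thesis
      unfolding tendsto_in_prob_def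
    proof (intro allI impI)
      fix U assume U: "open U" "l \<in> U"
      have "((\<lambda>\<delta>. iid.prob {\<omega> \<in> space (iid_seq (P a)).
          \<phi> \<delta> (?\<mu> + ci_scale N \<delta> * ((emp_mean (N \<delta>) \<omega> - ?\<mu>) / ci_scale N \<delta>)) \<notin> U}) \<longlongrightarrow> 0) (at_right 0)"
        using * U unfolding tendsto_in_prob_def by blast
      then show "((\<lambda>\<delta>. iid.prob {\<omega> \<in> space (iid_seq (P a)). \<phi> \<delta> (emp_mean (N \<delta>) \<omega>) \<notin> U}) \<longlongrightarrow> 0) (at_right 0)"
        by (rule Lim_transform_eventually) (use scale(1) in eventually_elim, simp)
    qed
  qed
  have right: "((\<lambda>x. (?R (fst x) (snd x) - ereal ?\<mu>) / ereal (ci_scale N (fst x))) \<longlongrightarrow> ereal ?s) ?F"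
    and left: "((\<lambda>x. (ereal ?\<mu> - ?L (fst x) (snd x)) / ereal (ci_scale N (fst x))) \<longlongrightarrow> ereal ?s) ?F"
    using lims by simp_all
  show "tendsto_in_prob (iid_seq (P a))
      (\<lambda>\<delta> \<omega>. (ci_right (kl_policy \<xi> b) (N \<delta>) \<delta> \<omega> - ereal ?\<mu>) / ereal (ci_scale N \<delta>)) (ereal ?s) (at_right 0)"
    unfolding ci_right_kl_policy
    by (rule in_prob_of_mean[of "\<lambda>\<delta> m. (kl_right \<xi> b (N \<delta>) (ln (2 / \<delta>)) m - ereal ?\<mu>) / ereal (ci_scale N \<delta>)"])
      (use right in \<open>simp add: case_prod_beta'\<close>)
  show "tendsto_in_prob (iid_seq (P a))
      (\<lambda>\<delta> \<omega>. (ereal ?\<mu> - ci_left (kl_policy \<xi> b) (N \<delta>) \<delta> \<omega>) / ereal (ci_scale N \<delta>)) (ereal ?s) (at_right 0)"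
    unfolding ci_left_kl_policy
    by (rule in_prob_of_mean[of "\<lambda>\<delta> m. (ereal ?\<mu> - kl_left \<xi> b (N \<delta>) (ln (2 / \<delta>)) m) / ereal (ci_scale N \<delta>)"])
      (use left in \<open>simp add: case_prod_beta'\<close>)
  \<comment> \<open>true also for infinite ends, with the conventions for differences of infinities\<close>
  have split: "(R - ereal m) / ereal e + (ereal m - L) / ereal e = (R - L) / ereal e"
    if "0 < e" for R L :: ereal and m e :: real
    using that by (cases R; cases L) (auto simp: field_simps)
  have "((\<lambda>x. (?R (fst x) (snd x) - ereal ?\<mu>) / ereal (ci_scale N (fst x))
      + (ereal ?\<mu> - ?L (fst x) (snd x)) / ereal (ci_scale N (fst x))) \<longlongrightarrow> ereal ?s + ereal ?s) ?F"
    by (rule tendsto_add_ereal[OF _ _ right left]) simp_all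
  then have "((\<lambda>x. (?R (fst x) (snd x) - ?L (fst x) (snd x)) / ereal (ci_scale N (fst x))) \<longlongrightarrow> ereal ?s + ereal ?s) ?F"
    by (rule Lim_transform_eventually) (use scale_pos in eventually_elim, rule split)
  then have width: "((\<lambda>x. (?R (fst x) (snd x) - ?L (fst x) (snd x)) / ereal (ci_scale N (fst x)))
      \<longlongrightarrow> ereal (2 * ?s)) ?F"
    by simp
  show "tendsto_in_prob (iid_seq (P a))
      (\<lambda>\<delta> \<omega>. (ci_right (kl_policy \<xi> b) (N \<delta>) \<delta> \<omega> - ci_left (kl_policy \<xi> b) (N \<delta>) \<delta> \<omega>) / ereal (ci_scale N \<delta>))
      (ereal (2 * ?s)) (at_right 0)"
    unfolding ci_left_kl_policy ci_right_kl_policy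
    by (rule in_prob_of_mean[of "\<lambda>\<delta> m. (kl_right \<xi> b (N \<delta>) (ln (2 / \<delta>)) m - kl_left \<xi> b (N \<delta>) (ln (2 / \<delta>)) m)
        / ereal (ci_scale N \<delta>)"]) (use width in \<open>simp add: case_prod_beta'\<close>)
qed

end

end

section \<open>Stability, regularity and width of the KL-based policy\<close>

theorem theorem7:
  fixes \<xi> :: "real measure" and b :: "real \<Rightarrow> real"
    and \<nu> :: "real measure" and N :: "real \<Rightarrow> nat"
  assumes "exp_family \<xi> b"
    and "\<nu> \<in> exp_models \<xi> b"
    and "\<And>\<delta>. 0 < \<delta> \<Longrightarrow> \<delta> < 1 \<Longrightarrow> 0 < N \<delta>"
    and "filterlim N at_top (at_right 0)"
    and "\<exists>c::ereal. 0 \<le> c \<and> ((\<lambda>\<delta>. ereal (sample_ratio N \<delta>)) \<longlongrightarrow> c) (at_right 0)"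
  shows "kl_policy \<xi> b \<in> Pi_CI_stable_regular \<xi> b \<nu> N \<and>
    (filterlim (sample_ratio N) at_top (at_right 0) \<longrightarrow>
      tendsto_in_prob (iid_seq \<nu>)
        (\<lambda>\<delta> \<omega>. (ci_right (kl_policy \<xi> b) (N \<delta>) \<delta> \<omega> - ci_left (kl_policy \<xi> b) (N \<delta>) \<delta> \<omega>)
          / ereal (ci_scale N \<delta>))
        (ereal (sqrt 8 * dist_sd \<nu>)) (at_right 0))"
proof -
  interpret exp_family \<xi> b by fact
  obtain a where a: "a \<in> nat_params \<xi>" and \<nu>: "\<nu> = exp_dist \<xi> b a"
    using assms(2) by (auto simp: exp_models_def)
  have mean: "dist_mean \<nu> = deriv b a"
    unfolding \<nu> using a by (rule mean_exp_dist)
  have N_pos: "eventually (\<lambda>\<delta>. 0 < N \<delta>) (at_right 0)"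
    using eventually_at_right_unit_interval by eventually_elim (use assms(3) in blast)
  obtain g where g: "0 \<le> g" "((\<lambda>\<delta>. ereal (ln (2 / \<delta>) / real (N \<delta>))) \<longlongrightarrow> g) (at_right 0)"
    using threshold_ratio_limit[OF N_pos] assms(5) by blast
  have stable: "kl_policy \<xi> b \<in> Pi_CI_stable \<xi> b \<nu> N"
    unfolding Pi_CI_stable_def mean
    using kl_policy_in_Pi_CI tendsto_in_prob_ends[OF a N_pos assms(4) g(2,1)]
      lower_end_le_deriv[OF a g(1)] upper_end_ge_deriv[OF a g(1)]
    unfolding \<nu> by blast
  have s: "0 \<le> sqrt (2 * deriv (deriv b) a)"
    using deriv2_pos[OF a] by simp
  have width: "2 * sqrt (2 * deriv (deriv b) a) = sqrt 8 * dist_sd \<nu>"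
  proof -
    have "sqrt 8 = 2 * sqrt 2"
      using real_sqrt_mult[of 4 2] by simp
    then show ?thesis
      unfolding \<nu> dist_sd_exp_dist[OF a] by (simp add: real_sqrt_mult)
  qed
  have "kl_policy \<xi> b \<in> Pi_CI_stable_regular \<xi> b \<nu> N"
    unfolding Pi_CI_stable_regular_def mean
    using stable s tendsto_in_prob_scaled_ends(1,2)[OF a N_pos] unfolding \<nu> by blast
  then show ?thesis
    using tendsto_in_prob_scaled_ends(3)[OF a N_pos] unfolding width \<nu> by blast
qed

end
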